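(* Let $\Omega\subseteq\mathbb{C}^d$ be a bounded, convex, balanced domain, and let $\mathcal{V}$ be an analytic subvariety of $\Omega$ that is relatively polynomially convex in $\Omega$. Assume there is an isometric linear extension operator $E: H^\infty(\mathcal{V})\to H^\infty(\Omega)$, i.e. $E$ is linear, $(Ef)|_{\mathcal{V}} = f$ and $\sup_{\Omega}|Ef| = \sup_{\mathcal{V}}|f|$ for every $f\in H^\infty(\mathcal{V})$. If any one of the following holds: (i) $\Omega$ is the polydisk $\mathbb{D}^d$; (ii) $\Omega$ is strictly convex; (iii) $E$ is multiplicative ($E(fg) = E(f)E(g)$ for all $f,g\in H^\infty(\mathcal{V})$), then $\mathcal{V}$ is a retract of $\Omega$.
   Context: $\mathbb{D}$ is the open unit disk. A domain $\Omega$ is balanced if $\lambda\Omega\subseteq\Omega$ for every $\lambda$ in the closed unit disk. An analytic subvariety of $\Omega$ is a relatively closed set $\mathcal{V}\subseteq\Omega$ such that each point of $\mathcal{V}$ has an open neighborhood $U$ and holomorphic $f_1,\dots,f_m$ on $U$ with $\mathcal{V}\cap U = \{\mu\in U: f_i(\mu)=0 \ \forall i\}$. A function on $\mathcal{V}$ is holomorphic if near each point of $\mathcal{V}$ it is the restriction of a holomorphic function defined on an open set of $\mathbb{C}^d$; $H^\infty(\mathcal{V})$ is the space of bounded holomorphic functions on $\mathcal{V}$ with the supremum norm, and $H^\infty(\Omega)$ likewise. $\mathcal{V}$ is relatively polynomially convex in $\Omega$ if for every $\lambda\in\Omega\setminus\mathcal{V}$ there is a polynomial $p$ with $|p(\lambda)|>\sup_{\mu\in\mathcal{V}}|p(\mu)|$.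 $\Omega$ is strictly convex if for every boundary point $\lambda$ there is a (real) hyperplane in $\mathbb{C}^d$ whose intersection with $\overline{\Omega}$ is $\{\lambda\}$. $\mathcal{V}$ is a retract of $\Omega$ if there is a holomorphic $r:\Omega\to\Omega$ with $r(\Omega)=\mathcal{V}$ and $r|_{\mathcal{V}}=\mathrm{id}_{\mathcal{V}}$. *)

theory Defs
  imports "HOL-Analysis.Analysis"
begin

definition holo_on :: "(complex^'n \<Rightarrow> complex) \<Rightarrow> (complex^'n) set \<Rightarrow> bool" where
  "holo_on f U \<longleftrightarrow> open U \<and>
     (\<forall>z\<in>U. \<exists>L. (f has_derivative L) (at z) \<and> (\<forall>c v. L (c *s v) = c * L v))"

definition holo_map_on :: "(complex^'n \<Rightarrow> complex^'m) \<Rightarrow> (complex^'n) set \<Rightarrow> bool" where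
  "holo_map_on F U \<longleftrightarrow> (\<forall>i. holo_on (\<lambda>z. F z $ i) U)"

definition domain :: "(complex^'n) set \<Rightarrow> bool" where
  "domain \<Omega> \<longleftrightarrow> open \<Omega> \<and> connected \<Omega> \<and> \<Omega> \<noteq> {}"

definition balanced :: "(complex^'n) set \<Rightarrow> bool" where
  "balanced \<Omega> \<longleftrightarrow> (\<forall>l::complex. cmod l \<le> 1 \<longrightarrow> (\<lambda>z. l *s z) ` \<Omega> \<subseteq> \<Omega>)"

definition analytic_subvariety :: "(complex^'n) set \<Rightarrow> (complex^'n) set \<Rightarrow> bool" where
  "analytic_subvariety V \<Omega> \<longleftrightarrow> V \<subseteq> \<Omega> \<and> closedin (top_of_set \<Omega>) V \<and>
     (\<forall>\<mu>\<in>V. \<exists>U (m::nat) fs. open U \<and> \<mu> \<in> U \<and> (\<forall>i<m. holo_on (fs i) U) \<and>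
        V \<inter> U = {x\<in>U. \<forall>i<m. fs i x = 0})"

definition holo_var :: "(complex^'n \<Rightarrow> complex) \<Rightarrow> (complex^'n) set \<Rightarrow> bool" where
  "holo_var f V \<longleftrightarrow> (\<forall>\<mu>\<in>V. \<exists>U g. open U \<and> \<mu> \<in> U \<and> holo_on g U \<and> (\<forall>x\<in>V \<inter> U. f x = g x))"

text \<open>H^infinity(V): bounded holomorphic functions on V; each is represented canonically
  by its extension by 0 outside V.\<close>
definition Hinf :: "(complex^'n) set \<Rightarrow> (complex^'n \<Rightarrow> complex) set" where
  "Hinf V = {f. holo_var f V \<and> bounded (f ` V) \<and> (\<forall>x. x \<notin> V \<longrightarrow> f x = 0)}"

inductive poly_fun :: "(complex^'n \<Rightarrow> complex) \<Rightarrow> bool" where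
  const: "poly_fun (\<lambda>x. c)"
| coord: "poly_fun (\<lambda>x. x $ i)"
| add: "poly_fun p \<Longrightarrow> poly_fun q \<Longrightarrow> poly_fun (\<lambda>x. p x + q x)"
| mult: "poly_fun p \<Longrightarrow> poly_fun q \<Longrightarrow> poly_fun (\<lambda>x. p x * q x)"

definition rel_poly_convex :: "(complex^'n) set \<Rightarrow> (complex^'n) set \<Rightarrow> bool" where
  "rel_poly_convex V \<Omega> \<longleftrightarrow>
     (\<forall>l\<in>\<Omega> - V. \<exists>p. poly_fun p \<and> cmod (p l) > (SUP \<mu>\<in>V. cmod (p \<mu>)))"

definition polydisk :: "(complex^'n) set" where
  "polydisk = {z. \<forall>i. cmod (z $ i) < 1}"

definition strictly_convex :: "(complex^'n) set \<Rightarrow> bool" where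
  "strictly_convex \<Omega> \<longleftrightarrow> (\<forall>l\<in>frontier \<Omega>. \<exists>a b. a \<noteq> 0 \<and>
      {x. inner a x = b} \<inter> closure \<Omega> = {l})"

definition retract_of_dom :: "(complex^'n) set \<Rightarrow> (complex^'n) set \<Rightarrow> bool" where
  "retract_of_dom V \<Omega> \<longleftrightarrow> (\<exists>r. holo_map_on r \<Omega> \<and> r ` \<Omega> = V \<and> (\<forall>x\<in>V. r x = x))"

end

theory Submission
  imports Defs "HOL-Complex_Analysis.Complex_Analysis"
begin

text \<open>
  Write \<open>r = (E z\<^sub>1, \<dots>, E z\<^sub>d)\<close> (the constant \<open>coord_map\<close>); since \<open>\<Omega>\<close> is a unit ball, \<open>r\<close> maps \<open>\<Omega>\<close> into itself and fixes \<open>V\<close>.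
  By relative polynomial convexity it suffices to find a holomorphic \<open>\<psi> : \<Omega> \<rightarrow> \<Omega>\<close> fixing \<open>V\<close> with
  \<open>\<bar>p (\<psi> z)\<bar> \<le> sup\<^sub>V \<bar>p\<bar>\<close> for all polynomials \<open>p\<close>.

  If \<open>E\<close> is multiplicative, \<open>E p = p \<circ> r\<close> and \<open>\<psi> = r\<close> works.
  If \<open>\<Omega>\<close> is strictly convex, let \<open>\<psi>\<close> be a holomorphic retraction onto the fixed point set \<open>M\<close> of \<open>r\<close>. For
  \<open>x \<in> M\<close> an affine function at \<open>x\<close> is bounded by its supremum on \<open>V\<close>, so peaking affine functions
  show that boundary points of \<open>M\<close> in \<open>\<partial>\<Omega>\<close> lie in the closure of \<open>V\<close>; conclude by the maximum principle.
  For the polydisk, choose \<open>\<psi>\<close> fixing \<open>V\<close> that depends on as few coordinates \<open>I\<close> as possible. If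
  \<open>\<psi>\<^sub>i \<noteq> z\<^sub>i\<close> for some \<open>i \<in> I\<close>, solving \<open>\<psi>\<^sub>i = z\<^sub>i\<close> for \<open>z\<^sub>i\<close> eliminates the coordinate \<open>i\<close>. So \<open>\<psi>\<^sub>i = z\<^sub>i\<close> and,
  applying this to \<open>r \<circ> \<psi>\<close>, also \<open>(E z\<^sub>i) \<circ> \<psi> = z\<^sub>i\<close>. As \<open>\<bar>z\<^sub>i\<bar> \<rightarrow> 1\<close> the functional \<open>f \<mapsto> E f (\<psi> z)\<close> becomes
  multiplicative against \<open>z\<^sub>i\<close>, hence \<open>E (z\<^sub>i g) \<circ> \<psi> = z\<^sub>i (E g \<circ> \<psi>)\<close>, and dividing \<open>p \<circ> \<psi> - p (\<psi> x)\<close>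
  by the \<open>z\<^sub>i - x\<^sub>i\<close> gives \<open>E p (\<psi> x) = p (\<psi> x)\<close>.

  The retraction onto the fixed points of \<open>R\<close> is a limit, as \<open>t \<rightarrow> 1\<close>, of the fixed points \<open>w\<close> of the strict
  contractions \<open>w \<mapsto> (1 - t) z + t R w\<close>, which depend holomorphically on \<open>z\<close>.
\<close>

no_notation fps_nth (infixl "$" 75)

section \<open>Holomorphic functions of several variables\<close>

lemma norm_vector_smult: "norm (c *s v) = cmod c * norm v" for v :: "complex^'n"
proof -
  have "(\<Sum>i\<in>UNIV. (cmod c * cmod (v $ i))\<^sup>2) = (cmod c)\<^sup>2 * (\<Sum>i\<in>UNIV. (cmod (v $ i))\<^sup>2)"
    by (simp add: power_mult_distrib sum_distrib_left)
  then show ?thesis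
    by (simp add: norm_vec_def L2_set_def norm_mult real_sqrt_mult)
qed

lemma of_real_vector_smult: "complex_of_real t *s v = t *\<^sub>R v"
  by (simp add: vec_eq_iff) (simp add: scaleR_conv_of_real)

lemma vec_expand_axis: "v = (\<Sum>i\<in>UNIV. v $ i *s axis i 1)" for v :: "complex^'n"
  by (rule basis_expansion [symmetric])

text \<open>A real basis vector of \<open>complex^'n\<close> has the form \<open>axis i u\<close>,
  so pairing with it sees only one complex component.\<close>

lemma has_derivative_vec:
  fixes F :: "'a::real_normed_vector \<Rightarrow> complex^'n"
  assumes "\<And>i. ((\<lambda>x. F x $ i) has_derivative (\<lambda>v. L v $ i)) (at z)"
  shows "(F has_derivative L) (at z)"
proof -
  have "((\<lambda>x. F x \<bullet> b) has_derivative (\<lambda>v. L v \<bullet> b)) (at z)" if b: "b \<in> Basis" for b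
  proof -
    obtain i u where bi: "b = axis i u"
      using b unfolding Basis_vec_def by blast
    show ?thesis
      using has_derivative_inner_left [OF assms, of i u] by (simp add: bi inner_axis)
  qed
  then show ?thesis
    using has_derivative_componentwise_within [of F L z UNIV] by simp
qed

lemma holo_on_open: "holo_on f U \<Longrightarrow> open U"
  by (simp add: holo_on_def)

lemma holo_on_const: "open U \<Longrightarrow> holo_on (\<lambda>x. c) U"
  unfolding holo_on_def by (auto intro!: exI [of _ "\<lambda>_. 0"])

lemma holo_on_coord: "open U \<Longrightarrow> holo_on (\<lambda>x. x $ i) U"
  unfolding holo_on_def
  by (auto intro!: exI [of _ "\<lambda>v. v $ i"] bounded_linear.has_derivative [OF bounded_linear_vec_nth] has_derivative_ident)

lemma holo_on_add:
  assumes "holo_on f U" "holo_on g U"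
  shows "holo_on (\<lambda>x. f x + g x) U"
  unfolding holo_on_def
proof (intro conjI ballI)
  show "open U" using assms by (simp add: holo_on_def)
  fix z assume "z \<in> U"
  then obtain L M where "(f has_derivative L) (at z)" "\<forall>c v. L (c *s v) = c * L v"
     "(g has_derivative M) (at z)" "\<forall>c v. M (c *s v) = c * M v"
    using assms unfolding holo_on_def by blast
  then show "\<exists>L. ((\<lambda>x. f x + g x) has_derivative L) (at z) \<and> (\<forall>c v. L (c *s v) = c * L v)"
    by (intro exI [of _ "\<lambda>v. L v + M v"]) (auto intro: has_derivative_add simp: algebra_simps)
qed

lemma holo_on_mult:
  assumes "holo_on f U" "holo_on g U"
  shows "holo_on (\<lambda>x. f x * g x) U"
  unfolding holo_on_def
proof (intro conjI ballI)
  show "open U" using assms by (simp add: holo_on_def)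
  fix z assume "z \<in> U"
  then obtain L M where "(f has_derivative L) (at z)" "\<forall>c v. L (c *s v) = c * L v"
     "(g has_derivative M) (at z)" "\<forall>c v. M (c *s v) = c * M v"
    using assms unfolding holo_on_def by blast
  then show "\<exists>L. ((\<lambda>x. f x * g x) has_derivative L) (at z) \<and> (\<forall>c v. L (c *s v) = c * L v)"
    by (intro exI [of _ "\<lambda>v. f z * M v + L v * g z"] conjI has_derivative_mult)
      (auto simp: algebra_simps)
qed

lemma holo_on_cmult: "holo_on f U \<Longrightarrow> holo_on (\<lambda>x. c * f x) U"
  by (intro holo_on_mult holo_on_const) (auto simp: holo_on_def)

lemma holo_on_diff: "holo_on f U \<Longrightarrow> holo_on g U \<Longrightarrow> holo_on (\<lambda>x. f x - g x) U"
  using holo_on_add [of f U "\<lambda>x. (-1) * g x", OF _ holo_on_cmult] by simp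

lemma holo_on_cdivide: "holo_on f U \<Longrightarrow> holo_on (\<lambda>x. f x / c) U"
  using holo_on_cmult [of f U "1/c"] by simp

lemma holo_on_subset: "holo_on f U \<Longrightarrow> W \<subseteq> U \<Longrightarrow> open W \<Longrightarrow> holo_on f W"
  unfolding holo_on_def by blast

lemma holo_on_poly: "poly_fun p \<Longrightarrow> open U \<Longrightarrow> holo_on p U"
  by (induction rule: poly_fun.induct)
    (auto intro: holo_on_const holo_on_coord holo_on_add holo_on_mult)

lemma holo_on_continuous: "holo_on f U \<Longrightarrow> continuous_on U f"
  unfolding holo_on_def
  by (auto intro!: continuous_at_imp_continuous_on dest: has_derivative_continuous)

lemma holo_on_cong_open:
  assumes "holo_on g W" "open U" "U \<subseteq> W" "\<And>x. x \<in> U \<Longrightarrow> f x = g x"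
  shows "holo_on f U"
  unfolding holo_on_def
proof (intro conjI ballI)
  fix z assume z: "z \<in> U"
  then obtain L where L: "(g has_derivative L) (at z)" "\<forall>c v. L (c *s v) = c * L v"
    using assms unfolding holo_on_def by blast
  have "(f has_derivative L) (at z)"
    using has_derivative_transform_within_open [OF L(1) assms(2) z] assms(4) by auto
  with L show "\<exists>L. (f has_derivative L) (at z) \<and> (\<forall>c v. L (c *s v) = c * L v)"
    by blast
qed (fact assms)

lemma holo_on_local:
  assumes "\<And>z. z \<in> U \<Longrightarrow> \<exists>W. z \<in> W \<and> W \<subseteq> U \<and> holo_on f W"
  shows "holo_on f U"
  unfolding holo_on_def
proof (intro conjI ballI)
  show "open U"
  proof (subst open_subopen, intro ballI)
    fix z assume "z \<in> U"
    then obtain W where "z \<in> W" "W \<subseteq> U" "holo_on f W"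
      using assms by blast
    then show "\<exists>T. open T \<and> z \<in> T \<and> T \<subseteq> U"
      using holo_on_open by blast
  qed
  show "\<exists>L. (f has_derivative L) (at z) \<and> (\<forall>c v. L (c *s v) = c * L v)" if "z \<in> U" for z
    using assms [OF that] unfolding holo_on_def by blast
qed

lemma holo_map_on_open: "holo_map_on F U \<Longrightarrow> open U"
  by (simp add: holo_map_on_def holo_on_def)

lemma holo_map_on_continuous: "holo_map_on F U \<Longrightarrow> continuous_on U F"
proof -
  assume F: "holo_map_on F U"
  have "continuous_on U (\<lambda>x. \<chi> i. F x $ i)"
    using F by (intro continuous_on_vec_lambda holo_on_continuous) (simp add: holo_map_on_def)
  then show ?thesis by simp
qed

lemma holo_on_compose:
  assumes g: "holo_on g W" and F: "holo_map_on F U" and sub: "F ` U \<subseteq> W"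
  shows "holo_on (\<lambda>z. g (F z)) U"
  unfolding holo_on_def
proof (intro conjI ballI)
  show "open U" using F by (rule holo_map_on_open)
  fix z assume z: "z \<in> U"
  have "\<forall>i. \<exists>L. ((\<lambda>z. F z $ i) has_derivative L) (at z) \<and> (\<forall>c v. L (c *s v) = c * L v)"
    using F z by (auto simp: holo_map_on_def holo_on_def)
  then obtain L where L: "\<And>i. ((\<lambda>z. F z $ i) has_derivative L i) (at z)" "\<And>i c v. L i (c *s v) = c * L i v"
    by metis
  have F': "(F has_derivative (\<lambda>v. \<chi> i. L i v)) (at z)"
    by (rule has_derivative_vec) (simp add: L)
  obtain M where M: "(g has_derivative M) (at (F z))" "\<And>c v. M (c *s v) = c * M v"
    using g sub z unfolding holo_on_def by blast
  have "((\<lambda>z. g (F z)) has_derivative (\<lambda>v. M (\<chi> i. L i v))) (at z)"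
    using has_derivative_compose [OF F' M(1)] .
  moreover have "(\<chi> i. L i (c *s v)) = c *s (\<chi> i. L i v)" for c v
    by (simp add: vec_eq_iff L)
  ultimately show "\<exists>L. ((\<lambda>z. g (F z)) has_derivative L) (at z) \<and> (\<forall>c v. L (c *s v) = c * L v)"
    using M(2) by (intro exI [of _ "\<lambda>v. M (\<chi> i. L i v)"]) auto
qed

lemma holo_map_on_compose:
  "holo_map_on G W \<Longrightarrow> holo_map_on F U \<Longrightarrow> F ` U \<subseteq> W \<Longrightarrow> holo_map_on (\<lambda>z. G (F z)) U"
  unfolding holo_map_on_def [of G] holo_map_on_def [of "\<lambda>z. G (F z)"]
  by (intro allI holo_on_compose [of _ W F U]) auto

section \<open>Restriction to complex lines and the maximum principle\<close>

lemma has_derivative_line: "((\<lambda>l. a + l *s v) has_derivative (\<lambda>l. l *s v)) (at (l::complex))"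
  for a :: "complex^'n"
proof (rule has_derivative_vec)
  fix i
  have "((\<lambda>l. a $ i + l * v $ i) has_derivative (\<lambda>l. l * v $ i)) (at l)"
    by (auto intro!: derivative_eq_intros)
  then show "((\<lambda>l. (a + l *s v) $ i) has_derivative (\<lambda>l. (l *s v) $ i)) (at l)"
    by simp
qed

text \<open>Complex linearity of the Frechet derivative makes every slice complex differentiable,
  which opens the way to one-variable theory.\<close>

lemma holo_on_line_deriv:
  assumes "(f has_derivative L) (at (a + l *s v))" "\<And>c v. L (c *s v) = c * L v"
  shows "((\<lambda>l. f (a + l *s v)) has_field_derivative L v) (at (l::complex))"
proof -
  have "((\<lambda>l. f (a + l *s v)) has_derivative (\<lambda>l. L (l *s v))) (at l)"
    using has_derivative_compose [OF has_derivative_line assms(1)] .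
  moreover have "(\<lambda>l. L (l *s v)) = (*) (L v)"
    by (simp add: fun_eq_iff assms(2))
  ultimately show ?thesis
    by (simp add: has_field_derivative_def)
qed

lemma holo_on_line:
  assumes "holo_on f U" "\<And>l. l \<in> S \<Longrightarrow> a + l *s v \<in> U"
  shows "(\<lambda>l. f (a + l *s v)) holomorphic_on S"
  unfolding holomorphic_on_def
proof
  fix l assume "l \<in> S"
  then obtain L where "(f has_derivative L) (at (a + l *s v))" "\<forall>c v. L (c *s v) = c * L v"
    using assms unfolding holo_on_def by blast
  then show "(\<lambda>l. f (a + l *s v)) field_differentiable at l within S"
    using holo_on_line_deriv [of f L a l v] field_differentiable_at_within
    unfolding field_differentiable_def by blast
qed

lemma open_line_preimage: "open U \<Longrightarrow> open {l::complex. a + l *s v \<in> U}" for a :: "complex^'n"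
proof -
  assume "open U"
  have "continuous_on UNIV (\<lambda>l. a + l *s v)"
    by (intro continuous_at_imp_continuous_on ballI has_derivative_continuous [OF has_derivative_line])
  then have "open ((\<lambda>l. a + l *s v) -` U)"
    using \<open>open U\<close> open_vimage by blast
  then show ?thesis by (simp add: vimage_def)
qed

lemma convex_line_preimage: "convex U \<Longrightarrow> convex {l::complex. a + l *s v \<in> U}" for a :: "complex^'n"
proof -
  assume U: "convex U"
  have "a + (u *\<^sub>R x + (1 - u) *\<^sub>R y) *s v = u *\<^sub>R (a + x *s v) + (1 - u) *\<^sub>R (a + y *s v)" for u x y
    unfolding vec_eq_iff by (simp add: scaleR_conv_of_real [where 'a = complex] algebra_simps)
  then show ?thesis
    using U unfolding convex_def
    by (metis (no_types, lifting) add_diff_cancel_left' mem_Collect_eq)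
qed

text \<open>The complex line through \<open>y\<close> and \<open>z\<close> meets the convex set
  \<open>U\<close> in a connected open set of parameters containing 0 and 1, where the one-variable
  principle applies.\<close>

lemma holo_on_max_modulus:
  assumes f: "holo_on f U" and U: "convex U" and y: "y \<in> U"
    and le: "\<And>z. z \<in> U \<Longrightarrow> cmod (f z) \<le> cmod (f y)" and z: "z \<in> U"
  shows "f z = f y"
proof -
  define S where "S = {l::complex. y + l *s (z - y) \<in> U}"
  have oU: "open U" using f by (rule holo_on_open)
  have "(\<lambda>l. f (y + l *s (z - y))) holomorphic_on S"
    by (rule holo_on_line [OF f]) (simp add: S_def)
  moreover have "open S" "connected S"
    unfolding S_def by (intro open_line_preimage oU convex_connected convex_line_preimage U)+
  moreover have "0 \<in> S" "1 \<in> S" using y z by (auto simp: S_def)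
  ultimately have "(\<lambda>l. f (y + l *s (z - y))) constant_on S"
    using maximum_modulus_principle [of "\<lambda>l. f (y + l *s (z - y))" S S 0] le by (auto simp: S_def)
  then obtain c where "\<And>l. l \<in> S \<Longrightarrow> f (y + l *s (z - y)) = c"
    by (auto simp: constant_on_def)
  from this [OF \<open>0 \<in> S\<close>] this [OF \<open>1 \<in> S\<close>] show ?thesis
    by simp
qed

section \<open>Schwarz-Pick and Cauchy estimates\<close>

lemma Moebius_compose':
  assumes "cmod w < 1" "cmod z < 1"
  shows "Moebius_function 0 (- w) (Moebius_function 0 w z) = z"
  by (rule Moebius_function_compose) (use assms in auto)

text \<open>Disk automorphisms before and after \<open>f\<close> move \<open>b\<close> and
  \<open>f b\<close> to the origin, the position in which Schwarz's lemma applies.\<close>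

lemma Moebius_conjugate:
  assumes f: "f holomorphic_on ball 0 1" "\<And>z. cmod z < 1 \<Longrightarrow> cmod (f z) < 1" and b: "cmod b < 1"
  defines "h \<equiv> \<lambda>z. Moebius_function 0 (f b) (f (Moebius_function 0 (- b) z))"
  shows "h holomorphic_on ball 0 1" "\<And>z. cmod z < 1 \<Longrightarrow> cmod (h z) < 1" "h 0 = 0"
proof -
  have m: "cmod (Moebius_function 0 (- b) z) < 1" if "cmod z < 1" for z
    using that b by (intro Moebius_function_norm_lt_1) auto
  have 1: "Moebius_function 0 (- b) holomorphic_on ball 0 1"
    using b by (intro Moebius_function_holomorphic) auto
  have 2: "(f \<circ> Moebius_function 0 (- b)) holomorphic_on ball 0 1"
    by (rule holomorphic_on_compose_gen [OF 1 f(1)]) (use m in auto)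
  have 3: "(Moebius_function 0 (f b) \<circ> (f \<circ> Moebius_function 0 (- b))) holomorphic_on ball 0 1"
    by (rule holomorphic_on_compose_gen [OF 2 Moebius_function_holomorphic]) (use m f b in auto)
  then show "h holomorphic_on ball 0 1"
    by (simp add: h_def o_def)
  show "cmod (h z) < 1" if "cmod z < 1" for z
    using that m f b unfolding h_def by (intro Moebius_function_norm_lt_1) auto
  show "h 0 = 0"
    by (simp add: h_def Moebius_function_simple)
qed

text \<open>Schwarz's lemma for the conjugated map; the denominators of the two pseudohyperbolic
  distances are cleared.\<close>

lemma Schwarz_Pick:
  assumes f: "f holomorphic_on ball 0 1" "\<And>z. cmod z < 1 \<Longrightarrow> cmod (f z) < 1"
    and a: "cmod a < 1" and b: "cmod b < 1"
  shows "cmod (f a - f b) * cmod (1 - cnj b * a) \<le> cmod (a - b) * cmod (1 - cnj (f b) * f a)"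
proof -
  define h where "h = (\<lambda>z. Moebius_function 0 (f b) (f (Moebius_function 0 (- b) z)))"
  have c: "h holomorphic_on ball 0 1" "\<And>z. cmod z < 1 \<Longrightarrow> cmod (h z) < 1" "h 0 = 0"
    using Moebius_conjugate [of f b] f b unfolding h_def by blast+
  have nz: "1 - cnj x * y \<noteq> 0" if "cmod x < 1" "cmod y < 1" for x y
  proof
    assume "1 - cnj x * y = 0"
    then have "cnj x * y = 1" by simp
    then have "cmod x * cmod y = 1"
      by (metis complex_mod_cnj norm_mult norm_one)
    then show False
      using that mult_strict_mono [of "cmod x" 1 "cmod y" 1] by auto
  qed
  have "cmod (h (Moebius_function 0 b a)) \<le> cmod (Moebius_function 0 b a)"
    by (rule Schwarz_Lemma(1) [OF c(1,3)]) (use a b in \<open>auto intro: Moebius_function_norm_lt_1 c\<close>)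
  then have "cmod ((f a - f b) / (1 - cnj (f b) * f a)) \<le> cmod ((a - b) / (1 - cnj b * a))"
    using a b by (simp add: h_def Moebius_compose') (simp add: Moebius_function_simple)
  then show ?thesis
    using nz [OF b a] nz [of "f b" "f a"] f a b by (simp add: norm_divide divide_simps)
qed

text \<open>Moving \<open>a\<close> to 0 leaves a nonzero fixed point \<open>w\<close>. This is
  equality in Schwarz's lemma, so \<open>h\<close> is a rotation, and fixing \<open>w\<close> makes
  it the identity.\<close>

lemma two_fixed_points_imp_id:
  assumes f: "f holomorphic_on ball 0 1" "\<And>z. cmod z < 1 \<Longrightarrow> cmod (f z) < 1"
    and a: "cmod a < 1" "f a = a" and b: "cmod b < 1" "f b = b" and ne: "a \<noteq> b" and z: "cmod z < 1"
  shows "f z = z"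
proof -
  define h where "h = (\<lambda>z. Moebius_function 0 (f a) (f (Moebius_function 0 (- a) z)))"
  have c: "h holomorphic_on ball 0 1" "\<And>z. cmod z < 1 \<Longrightarrow> cmod (h z) < 1" "h 0 = 0"
    using Moebius_conjugate [of f a] f a(1) unfolding h_def by blast+
  define w where "w = Moebius_function 0 a b"
  have w: "cmod w < 1"
    unfolding w_def using a b by (intro Moebius_function_norm_lt_1)
  have hw: "h w = w"
    unfolding h_def w_def using a b by (simp add: Moebius_compose')
  have "w \<noteq> 0"
    using Moebius_compose' [OF a(1) b(1)] ne
    by (metis w_def Moebius_compose' Moebius_function_eq_zero a(1))
  have "\<exists>z. cmod z < 1 \<and> z \<noteq> 0 \<and> cmod (h z) = cmod z"
    using w hw \<open>w \<noteq> 0\<close> by (intro exI [of _ w]) auto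
  then obtain \<alpha> where \<alpha>: "\<And>z. cmod z < 1 \<Longrightarrow> h z = \<alpha> * z"
    using Schwarz_Lemma(3) [OF c(1,3), of 0] c(2) by auto
  have "\<alpha> = 1"
    using \<alpha> [OF w] hw \<open>w \<noteq> 0\<close> by simp
  have mz: "cmod (Moebius_function 0 a z) < 1"
    using a z by (intro Moebius_function_norm_lt_1)
  have "Moebius_function 0 a (f z) = Moebius_function 0 a z"
    using \<alpha> [OF mz] a z \<open>\<alpha> = 1\<close> by (simp add: h_def Moebius_compose')
  then show ?thesis
    using Moebius_compose' [OF a(1) z] Moebius_compose' [OF a(1) f(2) [OF z]] by simp
qed

text \<open>The maximum principle on \<open>cball 0 r\<close> bounds \<open>h z\<close> by
  \<open>C * sqrt (1 - r)\<close>; then \<open>r\<close> tends to 1.\<close>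

lemma boundary_zero_imp_zero:
  assumes h: "h holomorphic_on ball 0 1"
    and le: "\<And>z. cmod z < 1 \<Longrightarrow> cmod (h z) \<le> C * sqrt (1 - cmod z)" and z: "cmod z < 1"
  shows "h z = 0"
proof -
  have 1: "cmod (h z) \<le> C * sqrt (1 - r)" if r: "cmod z < r" "r < 1" for r
  proof (rule maximum_modulus_frontier [of h "cball 0 r"])
    have r0: "r > 0" using r norm_ge_zero [of z] by linarith
    have sub: "cball 0 r \<subseteq> ball (0::complex) 1" using r by auto
    show "h holomorphic_on interior (cball 0 r)"
      using h sub interior_subset by (meson holomorphic_on_subset order_trans)
    show "continuous_on (closure (cball 0 r)) h"
      using h sub by (metis closed_cball closure_closed holomorphic_on_imp_continuous_on holomorphic_on_subset)
    show "cmod (h w) \<le> C * sqrt (1 - r)" if "w \<in> frontier (cball 0 r)" for w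
      using le [of w] that r r0 by (simp add: frontier_cball)
  qed (use r in auto)
  have "((\<lambda>r. C * sqrt (1 - r)) \<longlongrightarrow> C * sqrt (1 - 1)) (at_left 1)"
    by (intro tendsto_intros)
  moreover have "eventually (\<lambda>r. cmod (h z) \<le> C * sqrt (1 - r)) (at_left 1)"
    using 1 eventually_at_left_real [OF z] by (auto elim: eventually_mono)
  ultimately have "cmod (h z) \<le> C * sqrt (1 - 1)"
    by (intro tendsto_lowerbound) auto
  then show ?thesis by simp
qed

text \<open>Cauchy's inequality with radius 1/2 at the origin gives the first bound. With radius 1/4
  on \<open>cball 0 (1/2)\<close> it bounds the second derivative by \<open>32 * B\<close>, and
  Taylor's formula follows.\<close>

lemma quadratic_estimate_1:
  assumes u: "u holomorphic_on ball 0 1" and B: "\<And>l. cmod l < 1 \<Longrightarrow> cmod (u l) \<le> B"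
  shows "cmod (deriv u 0) \<le> 2 * B"
    and "cmod l \<le> 1/2 \<Longrightarrow> cmod (u l - u 0 - l * deriv u 0) \<le> 32 * B * (cmod l)\<^sup>2"
proof -
  have *: "cmod ((deriv ^^ n) u x) \<le> fact n * B / r ^ n" if "cmod x + r < 1" "r > 0" for n x r
  proof (rule Cauchy_inequality)
    have sub: "cball x r \<subseteq> ball 0 1"
    proof
      fix y assume "y \<in> cball x r"
      then show "y \<in> ball 0 1"
        using that norm_triangle_ineq [of x "y - x"] by (simp add: dist_norm norm_minus_commute)
    qed
    show "u holomorphic_on ball x r"
      using u sub by (meson ball_subset_cball holomorphic_on_subset order_trans)
    show "continuous_on (cball x r) u"
      using u sub by (meson holomorphic_on_imp_continuous_on holomorphic_on_subset)
    show "cmod (u y) \<le> B" if "cmod (x - y) = r" for y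
      using B [of y] sub that by (auto simp: dist_norm subset_iff)
  qed fact
  show "cmod (deriv u 0) \<le> 2 * B"
    using * [of 0 "1/2" 1] by simp
  show "cmod (u l - u 0 - l * deriv u 0) \<le> 32 * B * (cmod l)\<^sup>2" if l: "cmod l \<le> 1/2"
  proof -
    let ?S = "cball (0::complex) (1/2)"
    have d: "((deriv ^^ i) u has_field_derivative (deriv ^^ Suc i) u x) (at x within ?S)" if "x \<in> ?S" for i x
    proof -
      have "(deriv ^^ i) u holomorphic_on ball 0 1"
        by (rule holomorphic_higher_deriv [OF u]) auto
      then have "((deriv ^^ i) u has_field_derivative deriv ((deriv ^^ i) u) x) (at x)"
        by (rule holomorphic_derivI) (use that in auto)
      then show ?thesis
        by (simp add: has_field_derivative_at_within)
    qed
    have "cmod ((deriv ^^ 0) u l - (\<Sum>i\<le>1. (deriv ^^ i) u 0 * (l - 0) ^ i / fact i)) \<le> (32 * B) * cmod (l - 0) ^ Suc 1 / fact 1"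
    proof (rule complex_Taylor [of ?S 1])
      show "cmod ((deriv ^^ Suc 1) u x) \<le> 32 * B" if "x \<in> ?S" for x
        using * [of x "1/4" 2] that by (simp add: power2_eq_square eval_nat_numeral)
    qed (use d l in auto)
    then show ?thesis
      by (simp add: power2_eq_square algebra_simps)
  qed
qed

text \<open>The one-variable estimate on the complex line in direction \<open>w\<close>, rescaled so
  that the unit disk maps into \<open>ball z d\<close>. The constants depend only on
  \<open>B\<close> and \<open>d\<close>, hence are uniform over bounded families.\<close>

lemma quadratic_estimate:
  fixes f :: "complex^'n \<Rightarrow> complex"
  assumes f: "holo_on f U" and sub: "ball z d \<subseteq> U" and d: "d > 0"
    and B: "\<And>x. x \<in> U \<Longrightarrow> cmod (f x) \<le> B"
    and L: "(f has_derivative L) (at z)" "\<And>c v. L (c *s v) = c * L v"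
  shows "cmod (L w) \<le> 2 * B / d * norm w"
    and "norm w \<le> d / 2 \<Longrightarrow> cmod (f (z + w) - f z - L w) \<le> 32 * B / d\<^sup>2 * (norm w)\<^sup>2"
proof -
  have "z \<in> U" using sub d by auto
  have "cmod (L w) \<le> 2 * B / d * norm w \<and>
    (norm w \<le> d / 2 \<longrightarrow> cmod (f (z + w) - f z - L w) \<le> 32 * B / d\<^sup>2 * (norm w)\<^sup>2)"
  proof (cases "w = 0")
    case True
    then show ?thesis using L(2) [of 0 0] by simp
  next
    case False
    define v where "v = complex_of_real (d / norm w) *s w"
    define l where "l = complex_of_real (norm w / d)"
    have nv: "norm v = d"
      using False d by (simp add: v_def norm_vector_smult norm_divide)
    have w: "w = l *s v"
      using False d by (simp add: vec_eq_iff v_def l_def)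
    have inU: "z + m *s v \<in> U" if "m \<in> ball 0 1" for m
      using sub that nv d by (auto simp: dist_norm norm_vector_smult subset_iff)
    have hol: "(\<lambda>m. f (z + m *s v)) holomorphic_on ball 0 1"
      by (rule holo_on_line [OF f inU])
    have der: "deriv (\<lambda>m. f (z + m *s v)) 0 = L v"
      by (rule DERIV_imp_deriv, rule holo_on_line_deriv) (use L in auto)
    note q = quadratic_estimate_1 [OF hol, of B, unfolded der]
    have b: "cmod (f (z + m *s v)) \<le> B" if "cmod m < 1" for m
      using inU B that by auto
    have nl: "cmod l = norm w / d"
      using d by (simp add: l_def norm_divide)
    have Lw: "L w = l * L v" by (simp add: w L)
    have "cmod (L w) = norm w / d * cmod (L v)"
      by (simp add: Lw norm_mult nl)
    also have "\<dots> \<le> norm w / d * (2 * B)"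
      by (rule mult_left_mono [OF q(1)]) (use b d in auto)
    finally have 1: "cmod (L w) \<le> 2 * B / d * norm w"
      by (simp add: mult_ac)
    have "cmod (f (z + w) - f z - L w) \<le> 32 * B / d\<^sup>2 * (norm w)\<^sup>2" if "norm w \<le> d / 2"
      using q(2) [of l] b that d nl by (simp add: w [symmetric] Lw [symmetric] divide_simps power_divide)
    with 1 show ?thesis by blast
  qed
  then show "cmod (L w) \<le> 2 * B / d * norm w"
    and "norm w \<le> d / 2 \<Longrightarrow> cmod (f (z + w) - f z - L w) \<le> 32 * B / d\<^sup>2 * (norm w)\<^sup>2"
    by auto
qed

text \<open>The linear term contributes \<open>2 * B / d\<close>, and for
  \<open>norm w \<le> d / 2\<close> the quadratic remainder contributes \<open>16 * B / d\<close>.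
  The uniform constant supplies equicontinuity.\<close>

lemma holo_on_locally_Lipschitz:
  fixes f :: "complex^'n \<Rightarrow> complex"
  assumes f: "holo_on f U" and sub: "ball z d \<subseteq> U" and d: "d > 0"
    and B: "\<And>x. x \<in> U \<Longrightarrow> cmod (f x) \<le> B" and w: "norm w \<le> d / 2"
  shows "cmod (f (z + w) - f z) \<le> 18 * B / d * norm w"
proof -
  have "z \<in> U" using sub d by auto
  then have B0: "B \<ge> 0" using B [of z] norm_ge_zero [of "f z"] by linarith
  obtain L where L: "(f has_derivative L) (at z)" "\<And>c v. L (c *s v) = c * L v"
    using f \<open>z \<in> U\<close> unfolding holo_on_def by blast
  note q = quadratic_estimate [OF f sub d B L, of w]
  have "cmod (f (z + w) - f z) \<le> cmod (f (z + w) - f z - L w) + cmod (L w)"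
    using norm_triangle_ineq [of "f (z + w) - f z - L w" "L w"] by simp
  also have "\<dots> \<le> 32 * B / d\<^sup>2 * (norm w)\<^sup>2 + 2 * B / d * norm w"
    using q w by (intro add_mono) auto
  also have "32 * B / d\<^sup>2 * (norm w)\<^sup>2 \<le> 32 * B / d\<^sup>2 * (norm w * (d / 2))"
    unfolding power2_eq_square [of "norm w"] using w B0 by (intro mult_left_mono) auto
  also have "\<dots> = 16 * B / d * norm w"
    using d by (simp add: power2_eq_square)
  finally show ?thesis
    by (simp add: field_simps)
qed

section \<open>Pointwise limits and normal families\<close>

text \<open>The derivatives at \<open>z\<close> are bounded by the Cauchy estimate, so along a
  subsequence they converge to some \<open>M\<close>. The uniform quadratic estimate survives the
  limit and shows that \<open>M\<close> is the derivative of \<open>f\<close>.\<close>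

lemma holo_on_pointwise_limit:
  fixes F :: "nat \<Rightarrow> complex^'n \<Rightarrow> complex"
  assumes F: "\<And>n. holo_on (F n) U" and B: "\<And>n x. x \<in> U \<Longrightarrow> cmod (F n x) \<le> B"
    and lim: "\<And>x. x \<in> U \<Longrightarrow> (\<lambda>n. F n x) \<longlonglongrightarrow> f x"
  shows "holo_on f U"
  unfolding holo_on_def
proof (intro conjI ballI)
  show oU: "open U" using F [of 0] by (rule holo_on_open)
  fix z assume z: "z \<in> U"
  obtain d where d: "d > 0" "ball z d \<subseteq> U"
    using oU z by (meson open_contains_ball)
  have "\<forall>n. \<exists>L. (F n has_derivative L) (at z) \<and> (\<forall>c v. L (c *s v) = c * L v)"
    using F z unfolding holo_on_def by blast
  then obtain L where L: "\<And>n. (F n has_derivative L n) (at z)" "\<And>n c v. L n (c *s v) = c * L n v"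
    by metis
  note q = quadratic_estimate [OF F d(2,1) B L]
  \<comment> \<open>A complex-linear map is determined by its values on the axes, so a common
    subsequence for finitely many bounded scalar sequences suffices.\<close>
  obtain k l where k: "strict_mono (k::nat\<Rightarrow>nat)" and l: "\<And>i::'n. (\<lambda>n. L (k n) (axis i 1)) \<longlonglongrightarrow> l i"
  proof -
    have "cmod (L n (axis i 1)) \<le> 2 * B / d" for n i
      using q(1) [of n "axis i 1"] by (simp add: norm_axis_1)
    note bd = this
    show thesis
    proof (rule function_convergent_subsequence [of "UNIV :: 'n set" "\<lambda>n i. L n (axis i 1)" "2 * B / d"])
      show "countable (UNIV :: 'n set)" by (simp add: countable_finite)
      fix k :: "nat \<Rightarrow> nat"
      assume k: "strict_mono k" and "\<And>i. i \<in> UNIV \<Longrightarrow> \<exists>l. (\<lambda>n. L (k n) (axis i 1)) \<longlonglongrightarrow> l"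
      then have "\<forall>i. \<exists>l. (\<lambda>n. L (k n) (axis i 1)) \<longlonglongrightarrow> l" by simp
      from choice [OF this] obtain l where "\<forall>i. (\<lambda>n. L (k n) (axis i 1)) \<longlonglongrightarrow> l i" ..
      then show thesis by (intro that [OF k]) blast
    qed (rule bd)
  qed
  define M where "M v = (\<Sum>i\<in>UNIV. v $ i * l i)" for v
  have Llim: "(\<lambda>n. L (k n) v) \<longlonglongrightarrow> M v" for v
  proof -
    have "L n v = (\<Sum>i\<in>UNIV. v $ i * L n (axis i 1))" for n
    proof -
      have "linear (L n)"
        using L(1) [of n] has_derivative_bounded_linear bounded_linear.linear by blast
      then have "L n (\<Sum>i\<in>UNIV. v $ i *s axis i 1) = (\<Sum>i\<in>UNIV. L n (v $ i *s axis i 1))"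
        using linear_sum by blast
      then show ?thesis by (simp add: L flip: vec_expand_axis)
    qed
    then show ?thesis
      unfolding M_def by (simp only:) (intro tendsto_intros l)
  qed
  have flim: "(\<lambda>n. F (k n) x) \<longlonglongrightarrow> f x" if "x \<in> U" for x
    using LIMSEQ_subseq_LIMSEQ [OF lim [OF that] k] by (simp add: o_def)
  have est: "cmod (f (z + w) - f z - M w) \<le> 32 * B / d\<^sup>2 * (norm w)\<^sup>2" if w: "norm w \<le> d / 2" for w
  proof (rule tendsto_upperbound)
    have "z + w \<in> U" using w d by (auto simp: dist_norm subset_iff)
    then show "(\<lambda>n. cmod (F (k n) (z + w) - F (k n) z - L (k n) w)) \<longlonglongrightarrow> cmod (f (z + w) - f z - M w)"
      by (intro tendsto_intros flim Llim z)
  qed (use q(2) w in simp_all)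
  have bl: "bounded_linear M"
    unfolding M_def
    by (intro bounded_linear_sum bounded_linear_compose [OF bounded_linear_mult_left bounded_linear_vec_nth])
  have "(f has_derivative M) (at z)"
    unfolding has_derivative_at
  proof (intro conjI bl)
    show "(\<lambda>h. norm (f (z + h) - f z - M h) / norm h) \<midarrow>0\<rightarrow> 0"
    proof (rule Lim_null_comparison)
      have "eventually (\<lambda>h. h \<in> ball 0 (d/2)) (at (0 :: complex^'n))"
        by (rule eventually_at_in_open') (use d in auto)
      then show "eventually (\<lambda>h. norm (norm (f (z + h) - f z - M h) / norm h) \<le> 32 * B / d\<^sup>2 * norm h) (at 0)"
      proof (rule eventually_mono)
        fix h :: "complex^'n" assume "h \<in> ball 0 (d/2)"
        then show "norm (norm (f (z + h) - f z - M h) / norm h) \<le> 32 * B / d\<^sup>2 * norm h"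
          using est [of h] by (cases "h = 0") (simp_all add: pos_divide_le_eq power2_eq_square mult_ac)
      qed
      have "((\<lambda>h::complex^'n. 32 * B / d\<^sup>2 * norm h) \<longlongrightarrow> 32 * B / d\<^sup>2 * norm (0::complex^'n)) (at 0)"
        by (intro tendsto_intros)
      then show "((\<lambda>h::complex^'n. 32 * B / d\<^sup>2 * norm h) \<longlongrightarrow> 0) (at 0)"
        by simp
    qed
  qed
  moreover have "M (c *s v) = c * M v" for c v
    by (simp add: M_def sum_distrib_left mult_ac)
  ultimately show "\<exists>L. (f has_derivative L) (at z) \<and> (\<forall>c v. L (c *s v) = c * L v)"
    by blast
qed

lemma holo_map_on_pointwise_limit:
  fixes F :: "nat \<Rightarrow> complex^'n \<Rightarrow> complex^'m"
  assumes F: "\<And>n. holo_map_on (F n) U" and B: "\<And>n x. x \<in> U \<Longrightarrow> norm (F n x) \<le> B"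
    and lim: "\<And>x. x \<in> U \<Longrightarrow> (\<lambda>n. F n x) \<longlonglongrightarrow> f x"
  shows "holo_map_on f U"
  unfolding holo_map_on_def
proof
  fix i
  show "holo_on (\<lambda>z. f z $ i) U"
  proof (rule holo_on_pointwise_limit [of "\<lambda>n z. F n z $ i" U B])
    show "holo_on (\<lambda>z. F n z $ i) U" for n
      using F by (simp add: holo_map_on_def)
    show "cmod (F n x $ i) \<le> B" if "x \<in> U" for n x
      using B [OF that, of n] Finite_Cartesian_Product.norm_nth_le [of "F n x" i] by linarith
    show "(\<lambda>n. F n x $ i) \<longlonglongrightarrow> f x $ i" if "x \<in> U" for x
      by (intro tendsto_intros lim that)
  qed
qed

text \<open>Arzela-Ascoli: a diagonal subsequence converges on a countable dense set, and the
  uniform Lipschitz bound carries the Cauchy property to all of \<open>U\<close>.\<close>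

lemma Montel_pointwise:
  fixes F :: "nat \<Rightarrow> complex^'n \<Rightarrow> complex^'m"
  assumes F: "\<And>n. holo_map_on (F n) U" and B: "\<And>n x. x \<in> U \<Longrightarrow> norm (F n x) \<le> B"
  obtains k f where "strict_mono (k::nat\<Rightarrow>nat)" "holo_map_on f U"
    "\<And>x. x \<in> U \<Longrightarrow> (\<lambda>n. F (k n) x) \<longlonglongrightarrow> f x"
proof -
  have oU: "open U" using F [of 0] by (rule holo_map_on_open)
  obtain T where T: "countable T" "T \<subseteq> U" "U \<subseteq> closure T"
    using separable [of U] by blast
  have Bi: "cmod (F n x $ i) \<le> B" if "x \<in> U" for n x i
    using B [OF that, of n] Finite_Cartesian_Product.norm_nth_le [of "F n x" i] by linarith
  obtain k where k: "strict_mono (k::nat\<Rightarrow>nat)" and kT: "\<And>x. x \<in> T \<Longrightarrow> \<exists>l. (\<lambda>n. F (k n) x) \<longlonglongrightarrow> l"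
    using function_convergent_subsequence [OF T(1), of F B] B T(2) by blast
  have conv: "\<exists>l. (\<lambda>n. F (k n) x $ i) \<longlonglongrightarrow> l" if x: "x \<in> U" for x i
  proof -
    obtain d where d: "d > 0" "ball x d \<subseteq> U"
      using oU x by (meson open_contains_ball)
    have "Cauchy (\<lambda>n. F (k n) x $ i)"
      unfolding Cauchy_def
    proof (intro allI impI)
      fix e :: real assume e: "e > 0"
      \<comment> \<open>Adding 1 keeps \<open>K\<close> positive, so that \<open>e / (3 * K)\<close>
        is a positive tolerance.\<close>
      define K where "K = \<bar>18 * B / d\<bar> + 1"
      have K: "K > 0" unfolding K_def using abs_ge_zero [of "18 * B / d"] by linarith
      obtain t where t: "t \<in> T" "dist t x < min (d/2) (e / (3 * K))"
      proof -
        have "min (d/2) (e / (3 * K)) > 0" using K e d by simp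
        moreover have "x \<in> closure T" using T(3) x by blast
        ultimately show thesis using that unfolding closure_approachable by blast
      qed
      have nt: "norm (t - x) < d/2" "norm (t - x) < e / (3 * K)"
        using t by (auto simp: dist_norm)
      have lip: "cmod (F n t $ i - F n x $ i) < e/3" for n
      proof -
        have "cmod (F n (x + (t - x)) $ i - F n x $ i) \<le> 18 * B / d * norm (t - x)"
          using F [of n] nt Bi by (intro holo_on_locally_Lipschitz [of _ U, OF _ d(2,1)]) (auto simp: holo_map_on_def)
        also have "\<dots> \<le> K * norm (t - x)"
          unfolding K_def using abs_ge_self [of "18 * B / d"] by (intro mult_right_mono) (linarith, simp)
        also have "\<dots> < e / 3"
          using nt K by (simp add: field_simps)
        finally show ?thesis by simp
      qed
      obtain l where "(\<lambda>n. F (k n) t) \<longlonglongrightarrow> l" using kT t by blast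
      then have "Cauchy (\<lambda>n. F (k n) t $ i)"
        by (intro LIMSEQ_imp_Cauchy [of _ "l $ i"] tendsto_intros)
      then obtain N where N: "\<And>m n. m \<ge> N \<Longrightarrow> n \<ge> N \<Longrightarrow> cmod (F (k m) t $ i - F (k n) t $ i) < e/3"
      proof -
        have "e / 3 > 0" using e by simp
        then obtain N where "\<forall>m\<ge>N. \<forall>n\<ge>N. dist (F (k m) t $ i) (F (k n) t $ i) < e / 3"
          using \<open>Cauchy _\<close> unfolding Cauchy_def by blast
        then show thesis by (intro that) (auto simp: dist_norm)
      qed
      show "\<exists>M. \<forall>m\<ge>M. \<forall>n\<ge>M. dist (F (k m) x $ i) (F (k n) x $ i) < e"
      proof (intro exI [of _ N] allI impI)
        fix m n assume "N \<le> m" "N \<le> n"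
        then have "cmod (F (k m) t $ i - F (k n) t $ i) < e/3" by (rule N)
        moreover have "F (k m) x $ i - F (k n) x $ i = (F (k m) t $ i - F (k n) t $ i) - (F (k m) t $ i - F (k m) x $ i)
            + (F (k n) t $ i - F (k n) x $ i)"
          by simp
        ultimately show "dist (F (k m) x $ i) (F (k n) x $ i) < e"
          using lip [of "k m"] lip [of "k n"] norm_triangle_ineq4 [of "F (k m) t $ i - F (k n) t $ i" "F (k m) t $ i - F (k m) x $ i"]
            norm_triangle_ineq [of "(F (k m) t $ i - F (k n) t $ i) - (F (k m) t $ i - F (k m) x $ i)" "F (k n) t $ i - F (k n) x $ i"]
          unfolding dist_norm by simp
      qed
    qed
    then show ?thesis
      using Cauchy_convergent convergent_def by blast
  qed
  define f where "f x = (\<chi> i. lim (\<lambda>n. F (k n) x $ i))" for x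
  have lim: "(\<lambda>n. F (k n) x) \<longlonglongrightarrow> f x" if "x \<in> U" for x
  proof (rule vec_tendstoI)
    show "(\<lambda>n. F (k n) x $ i) \<longlonglongrightarrow> f x $ i" for i
      using conv [OF that, of i] unfolding convergent_def [symmetric] convergent_LIMSEQ_iff
      by (simp add: f_def)
  qed
  show thesis
    by (rule that [OF k holo_map_on_pointwise_limit [of "\<lambda>n. F (k n)", OF F B lim] lim])
qed

section \<open>Bounded convex balanced domains\<close>

text \<open>The complex-linear functional with real part \<open>a \<bullet> x\<close>; through it,
  real supporting hyperplanes yield holomorphic functions.\<close>

definition cinner :: "complex^'n \<Rightarrow> complex^'n \<Rightarrow> complex" where
  "cinner a x = (\<Sum>i\<in>UNIV. cnj (a $ i) * x $ i)"

lemma Re_cinner: "Re (cinner a x) = a \<bullet> x"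
  by (simp add: cinner_def inner_vec_def inner_complex_def)

lemma cinner_smult: "cinner a (c *s x) = c * cinner a x"
  by (simp add: cinner_def sum_distrib_left mult_ac)

lemma cinner_scaleR: "cinner a (r *\<^sub>R x) = of_real r * cinner a x"
  using cinner_smult [of a "of_real r" x] by (simp add: of_real_vector_smult)

lemma poly_fun_sum:
  assumes "\<And>i. i \<in> A \<Longrightarrow> poly_fun (f i)"
  shows "poly_fun (\<lambda>x. \<Sum>i\<in>A. f i x)"
  using assms
proof (induction A rule: infinite_finite_induct)
  case (insert i A)
  have "poly_fun (f i)" "poly_fun (\<lambda>x. \<Sum>i\<in>A. f i x)"
    by (rule insert.prems, simp, rule insert.IH, rule insert.prems, simp)
  from poly_fun.add [OF this] insert.hyps show ?case
    by (simp only: sum.insert not_False_eq_True)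
qed (simp_all only: sum.infinite sum.empty poly_fun.const not_False_eq_True)

lemma poly_fun_cinner: "poly_fun (cinner a)"
  unfolding cinner_def [abs_def]
  by (intro poly_fun_sum poly_fun.mult poly_fun.const poly_fun.coord)

text \<open>A triangle inequality for the pseudohyperbolic distance: 0 and \<open>u\<close> are
  within \<open>s\<close> of each other, as are \<open>u\<close> and \<open>v\<close>, and the
  extreme value \<open>(s + s) / (1 + s * s)\<close> occurs when the points line up on a
  diameter.\<close>

lemma pseudo_hyperbolic_bound:
  assumes s: "0 < s" "s < 1" and u: "cmod u \<le> s" and v: "cmod v \<le> 1"
    and le: "cmod (v - u) \<le> s * cmod (1 - cnj u * v)"
  shows "cmod v \<le> 2 * s / (1 + s\<^sup>2)"
proof -
  define X a m where "X = Re (cnj u * v)" and "a = cmod u" and "m = cmod v"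
  have am: "0 \<le> a" "a \<le> s" "0 \<le> m" "m \<le> 1" "a * m \<le> 1"
    using u v s by (auto simp: a_def m_def intro: mult_le_one)
  have s2: "0 \<le> 1 - s\<^sup>2" using s by (simp add: power_le_one)
  have "(cmod (v - u))\<^sup>2 \<le> s\<^sup>2 * (cmod (1 - cnj u * v))\<^sup>2"
    using le power_mono [of "cmod (v - u)" "s * cmod (1 - cnj u * v)" 2] by (simp add: power_mult_distrib)
  moreover have "(cmod (v - u))\<^sup>2 = m\<^sup>2 + a\<^sup>2 - 2 * X"
    unfolding cmod_power2 X_def a_def m_def by (simp add: power2_eq_square algebra_simps)
  moreover have "(cmod (1 - cnj u * v))\<^sup>2 = 1 + a\<^sup>2 * m\<^sup>2 - 2 * X"
    unfolding cmod_power2 X_def a_def m_def by (simp add: power2_eq_square algebra_simps)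
  ultimately have 1: "m\<^sup>2 + a\<^sup>2 - 2 * X - s\<^sup>2 * (1 + a\<^sup>2 * m\<^sup>2 - 2 * X) \<le> 0"
    by simp
  \<comment> \<open>Replacing \<open>X\<close> by its upper bound \<open>a * m\<close> reduces the
    estimate to moduli.\<close>
  have "X \<le> a * m"
    using complex_Re_le_cmod [of "cnj u * v"] by (simp add: norm_mult X_def a_def m_def)
  then have 2: "(X - a * m) * (1 - s\<^sup>2) \<le> 0"
    using s2 by (simp add: mult_nonpos_nonneg)
  have "(m - a)\<^sup>2 - (s * (1 - a * m))\<^sup>2
      = (m\<^sup>2 + a\<^sup>2 - 2 * X - s\<^sup>2 * (1 + a\<^sup>2 * m\<^sup>2 - 2 * X)) + 2 * ((X - a * m) * (1 - s\<^sup>2))"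
    by algebra
  then have "(m - a)\<^sup>2 \<le> (s * (1 - a * m))\<^sup>2"
    using 1 2 by linarith
  then have 3: "m - a \<le> s * (1 - a * m)"
    using s am by (intro power2_le_imp_le [of "m - a"]) auto
  have "(m * (1 + s\<^sup>2) - 2 * s) * (1 + s * a)
      = (m - a - s * (1 - a * m)) * (1 + s\<^sup>2) + (a - s) * (1 - s\<^sup>2)"
    by algebra
  also have "\<dots> \<le> 0"
    using 3 am s2 by (intro add_nonpos_nonpos mult_nonpos_nonneg) auto
  finally have "m * (1 + s\<^sup>2) - 2 * s \<le> 0"
    using s am by (simp add: mult_le_0_iff add_pos_nonneg) (smt (verit) mult_nonneg_nonneg)
  moreover have "1 + s\<^sup>2 > 0" by (simp add: add_pos_nonneg)
  ultimately show ?thesis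
    by (simp add: m_def pos_le_divide_eq)
qed

locale balanced_convex_domain =
  fixes \<Omega> :: "(complex^'n) set"
  assumes open_dom: "open \<Omega>" and convex_dom: "convex \<Omega>" and bounded_dom: "bounded \<Omega>"
    and balanced_dom: "balanced \<Omega>" and nonempty_dom: "\<Omega> \<noteq> {}"
begin

lemma smult_mem: "cmod l \<le> 1 \<Longrightarrow> z \<in> \<Omega> \<Longrightarrow> l *s z \<in> \<Omega>"
  using balanced_dom by (simp add: balanced_def image_subset_iff)

lemma zero_mem: "0 \<in> \<Omega>"
  using smult_mem [of 0] nonempty_dom by auto

lemma shrink_mem:
  assumes "z \<in> \<Omega>"
  obtains s w where "0 < s" "s < 1" "w \<in> \<Omega>" "z = s *\<^sub>R w"
proof -
  obtain e where e: "e > 0" "ball z e \<subseteq> \<Omega>"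
    using open_dom assms by (meson open_contains_ball)
  define d where "d = e / (2 * (norm z + 1))"
  have d: "d > 0" using e by (simp add: d_def add_nonneg_pos)
  have "d * norm z < e"
  proof -
    have "norm z * e < e * (2 * (norm z + 1))"
    proof -
      have "e * norm z \<ge> 0" using e by simp
      then show ?thesis using e(1) unfolding distrib_left mult.commute [of "norm z"] by linarith
    qed
    moreover have "2 * (norm z + 1) > 0" by (simp add: add_nonneg_pos)
    ultimately show ?thesis
      by (simp add: d_def pos_divide_less_eq mult_ac)
  qed
  moreover have "dist z ((1 + d) *\<^sub>R z) = d * norm z"
    using d by (simp add: dist_norm scaleR_add_left)
  ultimately have "(1 + d) *\<^sub>R z \<in> \<Omega>"
    using e by auto
  moreover have "z = (1 / (1 + d)) *\<^sub>R ((1 + d) *\<^sub>R z)"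
    using d by simp
  ultimately show thesis
    using d by (intro that [of "1 / (1 + d)" "(1 + d) *\<^sub>R z"]) (simp_all add: divide_simps)
qed

lemma shrink_closure_mem:
  assumes "w \<in> closure \<Omega>" "0 \<le> s" "s < 1"
  shows "s *\<^sub>R w \<in> \<Omega>"
proof -
  have "w - (1 - s) *\<^sub>R (w - 0) \<in> interior \<Omega>"
    using assms zero_mem open_dom
    by (intro mem_interior_closure_convex_shrink convex_dom) (simp_all add: interior_open)
  then show ?thesis
    using open_dom by (simp add: interior_open algebra_simps)
qed

text \<open>Balancedness allows a rotation of \<open>x\<close> that makes \<open>cinner a x\<close>
  real and nonnegative, so that its modulus becomes a real part.\<close>

lemma norm_cinner_le:
  assumes "\<And>x. x \<in> \<Omega> \<Longrightarrow> a \<bullet> x \<le> b" and x: "x \<in> \<Omega>"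
  shows "cmod (cinner a x) \<le> b"
proof (cases "cinner a x = 0")
  case True
  then show ?thesis using assms(1) [OF zero_mem] by simp
next
  case False
  define c where "c = cnj (cinner a x) / cmod (cinner a x)"
  have "cmod c \<le> 1" using False by (simp add: c_def norm_divide)
  then have "a \<bullet> (c *s x) \<le> b"
    using assms smult_mem by blast
  also have "a \<bullet> (c *s x) = Re (c * cinner a x)"
    by (simp add: Re_cinner [symmetric] cinner_smult)
  also have "c * cinner a x = of_real (cmod (cinner a x))"
    using False by (simp add: c_def complex_norm_square [symmetric] mult.commute power2_eq_square)
  finally show ?thesis by simp
qed

text \<open>A ball around 0 inside \<open>\<Omega>\<close> forces \<open>b > 0\<close>, and writing
  \<open>x = s *\<^sub>R w\<close> with \<open>s < 1\<close> leaves room below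
  \<open>b\<close>.\<close>

lemma norm_cinner_less:
  assumes "\<And>x. x \<in> \<Omega> \<Longrightarrow> a \<bullet> x \<le> b" and x: "x \<in> \<Omega>" and a: "a \<noteq> 0"
  shows "cmod (cinner a x) < b"
proof -
  obtain e where e: "e > 0" "ball 0 e \<subseteq> \<Omega>"
    using open_dom zero_mem by (meson open_contains_ball)
  have "(e / (2 * norm a)) *\<^sub>R a \<in> \<Omega>"
    using e a by (auto simp: subset_iff)
  then have "a \<bullet> ((e / (2 * norm a)) *\<^sub>R a) \<le> b"
    using assms(1) by blast
  moreover have "a \<bullet> ((e / (2 * norm a)) *\<^sub>R a) > 0"
    using a e by simp
  ultimately have b: "b > 0" by linarith
  obtain s w where s: "0 < s" "s < 1" "w \<in> \<Omega>" "x = s *\<^sub>R w"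
    using shrink_mem [OF x] .
  have "cmod (cinner a x) = s * cmod (cinner a w)"
    using s by (simp add: cinner_scaleR norm_mult)
  also have "\<dots> \<le> s * b"
    using norm_cinner_le [OF assms(1) s(3)] s by (intro mult_left_mono) auto
  also have "\<dots> < b" using s b by simp
  finally show ?thesis .
qed

text \<open>The hypothesis \<open>le\<close> only places the values of \<open>F\<close> in the
  closure of \<open>\<Omega>\<close>. If a value fell outside \<open>\<Omega>\<close>, a supporting
  functional composed with \<open>F\<close> would attain its maximum modulus \<open>b\<close>, hence
  be constant, against \<open>F p \<in> \<Omega>\<close>.\<close>

lemma maps_into_dom:
  assumes F: "holo_map_on F \<Omega>"
    and le: "\<And>a b z. (\<And>x. x \<in> \<Omega> \<Longrightarrow> cmod (cinner a x) \<le> b) \<Longrightarrow> z \<in> \<Omega> \<Longrightarrow> cmod (cinner a (F z)) \<le> b"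
    and p: "p \<in> \<Omega>" "F p \<in> \<Omega>"
  shows "F ` \<Omega> \<subseteq> \<Omega>"
proof (rule image_subsetI, rule ccontr)
  fix z assume z: "z \<in> \<Omega>" "F z \<notin> \<Omega>"
  have "\<exists>a b. a \<noteq> 0 \<and> (\<forall>x\<in>\<Omega>. a \<bullet> x \<le> b) \<and> (\<forall>x\<in>{F z}. a \<bullet> x \<ge> b)"
    by (rule separating_hyperplane_sets) (use convex_dom nonempty_dom z in auto)
  then obtain a b where ab: "a \<noteq> 0" "\<And>x. x \<in> \<Omega> \<Longrightarrow> a \<bullet> x \<le> b" "a \<bullet> F z \<ge> b"
    by auto
  have hol: "holo_on (\<lambda>w. cinner a (F w)) \<Omega>"
    by (rule holo_on_compose [OF holo_on_poly [OF poly_fun_cinner open_UNIV] F]) auto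
  have le': "cmod (cinner a (F w)) \<le> b" if "w \<in> \<Omega>" for w
  proof (rule le)
    show "cmod (cinner a x) \<le> b" if "x \<in> \<Omega>" for x
      using ab(2) that by (rule norm_cinner_le)
  qed fact
  have "b \<le> cmod (cinner a (F z))"
    using ab(3) complex_Re_le_cmod [of "cinner a (F z)"] by (simp add: Re_cinner)
  then have "cinner a (F p) = cinner a (F z)"
    by (intro holo_on_max_modulus [OF hol convex_dom z(1) _ p(1)]) (use le' order_trans in blast)
  then show False
    using norm_cinner_less [OF ab(2) p(2) ab(1)] \<open>b \<le> cmod (cinner a (F z))\<close> by simp
qed

lemma closure_norm_cinner_le:
  assumes "\<And>x. x \<in> \<Omega> \<Longrightarrow> cmod (cinner a x) \<le> b" "y \<in> closure \<Omega>"
  shows "cmod (cinner a y) \<le> b"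
proof (rule continuous_le_on_closure [of \<Omega> "\<lambda>x. cmod (cinner a x)"])
  show "continuous_on (closure \<Omega>) (\<lambda>x. cmod (cinner a x))"
    unfolding cinner_def by (intro continuous_intros)
qed (use assms in auto)

text \<open>Schwarz-Pick on two disks through 0: along \<open>x\<close> the zero gives
  \<open>cmod (f 0) \<le> s\<close>, and along \<open>y\<close> the pseudohyperbolic distance from
  \<open>f 0\<close> to \<open>f (s *\<^sub>R y)\<close> is at most \<open>s\<close>.\<close>

lemma norm_shrunk_le:
  assumes f: "holo_on f \<Omega>" and le: "\<And>w. w \<in> \<Omega> \<Longrightarrow> cmod (f w) \<le> 1"
    and s: "0 < s" "s < 1" and x: "x \<in> \<Omega>" and y: "y \<in> \<Omega>" and fx: "f (s *\<^sub>R x) = 0"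
  shows "cmod (f (s *\<^sub>R y)) \<le> 2 * s / (1 + s\<^sup>2)"
proof -
  have sx: "s *\<^sub>R x \<in> \<Omega>"
    using smult_mem [of "of_real s" x] s x by (simp add: of_real_vector_smult)
  \<comment> \<open>Schwarz-Pick needs values in the open disk; a value of modulus 1 would make
    \<open>f\<close> constant, although it has a zero.\<close>
  have less: "cmod (f w) < 1" if w: "w \<in> \<Omega>" for w
  proof (rule ccontr)
    assume "\<not> cmod (f w) < 1"
    then have 1: "cmod (f w) \<ge> 1" by simp
    then have "f (s *\<^sub>R x) = f w"
      by (intro holo_on_max_modulus [OF f convex_dom w _ sx]) (use le order_trans in blast)
    with fx 1 show False by simp
  qed
  have hol: "(\<lambda>l. f (0 + l *s z)) holomorphic_on ball 0 1" if "z \<in> \<Omega>" for z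
    by (rule holo_on_line [OF f]) (use that smult_mem in auto)
  have sp: "cmod (f (a *s z) - f (b *s z)) * cmod (1 - cnj b * a) \<le> cmod (a - b) * cmod (1 - cnj (f (b *s z)) * f (a *s z))"
    if "z \<in> \<Omega>" "cmod a < 1" "cmod b < 1" for z a b
    using Schwarz_Pick [OF hol [OF that(1)], of a b] less smult_mem [OF _ that(1)] that by simp
  define u where "u = f 0"
  define v where "v = f (s *\<^sub>R y)"
  have u: "cmod u \<le> s"
    using sp [OF x, of 0 "of_real s"] s fx by (simp add: of_real_vector_smult u_def)
  have "cmod (v - u) \<le> s * cmod (1 - cnj u * v)"
    using sp [OF y, of "of_real s" 0] s by (simp add: of_real_vector_smult u_def v_def)
  moreover have "cmod v \<le> 1"
    unfolding v_def using less [OF smult_mem [of "of_real s" y]] s y by (simp add: of_real_vector_smult)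
  ultimately show ?thesis
    using pseudo_hyperbolic_bound [OF s u] by (simp add: v_def)
qed

end

section \<open>Retractions onto fixed point sets\<close>

context balanced_convex_domain
begin

text \<open>A one-sided form of the Caratheodory pseudodistance being at most \<open>\<kappa>\<close>.\<close>
definition separation_le :: "complex^'n \<Rightarrow> complex^'n \<Rightarrow> real \<Rightarrow> bool" where
  "separation_le a b \<kappa> \<longleftrightarrow>
    (\<forall>f. holo_on f \<Omega> \<longrightarrow> (\<forall>w\<in>\<Omega>. cmod (f w) \<le> 1) \<longrightarrow> f a = 0 \<longrightarrow> cmod (f b) \<le> \<kappa>)"

text \<open>The composite of \<open>f\<close> with \<open>F\<close> vanishes at \<open>a\<close> and
  is bounded by \<open>2 * s / (1 + s\<^sup>2)\<close>, by \<open>norm_shrunk_le\<close>; divided by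
  that bound it competes in the definition of \<open>separation_le a b \<kappa>\<close>.\<close>

lemma separation_le_shrinking_map:
  assumes F: "holo_map_on F \<Omega>" and s: "0 < s" "s < 1"
    and img: "\<And>w. w \<in> \<Omega> \<Longrightarrow> \<exists>x\<in>\<Omega>. F w = s *\<^sub>R x"
    and a: "a \<in> \<Omega>" and sep: "separation_le a b \<kappa>"
  shows "separation_le (F a) (F b) (2 * s / (1 + s\<^sup>2) * \<kappa>)"
  unfolding separation_le_def
proof (intro allI impI)
  fix f assume f: "holo_on f \<Omega>" "\<forall>w\<in>\<Omega>. cmod (f w) \<le> 1" "f (F a) = 0"
  define q where "q = 2 * s / (1 + s\<^sup>2)"
  have q: "q > 0" using s by (simp add: q_def add_pos_nonneg)
  have sub: "F ` \<Omega> \<subseteq> \<Omega>"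
  proof
    fix y assume "y \<in> F ` \<Omega>"
    then obtain x where "x \<in> \<Omega>" "y = s *\<^sub>R x" using img by blast
    then show "y \<in> \<Omega>"
      using smult_mem [of "of_real s" x] s by (simp add: of_real_vector_smult)
  qed
  have le: "cmod (f (F w)) \<le> q" if w: "w \<in> \<Omega>" for w
  proof -
    obtain x where x: "x \<in> \<Omega>" "F a = s *\<^sub>R x" using img a by blast
    obtain y where y: "y \<in> \<Omega>" "F w = s *\<^sub>R y" using img w by blast
    have "cmod (f (s *\<^sub>R y)) \<le> 2 * s / (1 + s\<^sup>2)"
      by (rule norm_shrunk_le [OF f(1) _ s x(1) y(1)]) (use f x in auto)
    then show ?thesis by (simp add: y q_def)
  qed
  have "holo_on (\<lambda>w. f (F w) / q) \<Omega>"
    by (intro holo_on_cdivide holo_on_compose [OF f(1) F sub])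
  moreover have "\<forall>w\<in>\<Omega>. cmod (f (F w) / q) \<le> 1"
    using le q by (simp add: norm_divide)
  ultimately have "cmod (f (F b) / q) \<le> \<kappa>"
    using sep [unfolded separation_le_def, rule_format, of "\<lambda>w. f (F w) / q"] f(3) by simp
  then show "cmod (f (F b)) \<le> 2 * s / (1 + s\<^sup>2) * \<kappa>"
    unfolding q_def [symmetric] using q by (simp add: norm_divide pos_divide_le_eq mult.commute)
qed

text \<open>The Earle-Hamilton fixed point theorem in this setting: \<open>F\<close> contracts the
  separation of points by a factor \<open>q < 1\<close>, so its orbits are Cauchy.\<close>

lemma shrinking_map_iterates:
  assumes F: "holo_map_on F \<Omega>" and s: "0 < s" "s < 1"
    and img: "\<And>w. w \<in> \<Omega> \<Longrightarrow> \<exists>x\<in>\<Omega>. F w = s *\<^sub>R x" and z: "z \<in> \<Omega>"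
  obtains w where "w \<in> \<Omega>" "(\<lambda>k. (F ^^ k) z) \<longlonglongrightarrow> w" "F w = w"
proof -
  define q where "q = 2 * s / (1 + s\<^sup>2)"
  have p2: "1 + s\<^sup>2 > 0" by (simp add: add_pos_nonneg)
  have q: "q > 0" using s p2 by (simp add: q_def)
  have "(1 - s)\<^sup>2 > 0" using s by simp
  then have "q < 1"
    using p2 by (simp add: q_def pos_divide_less_eq power2_eq_square algebra_simps)
  obtain B where B: "B > 0" "\<And>w. w \<in> \<Omega> \<Longrightarrow> norm w \<le> B"
    using bounded_dom bounded_pos by blast
  have sub: "F w \<in> \<Omega>" if w: "w \<in> \<Omega>" for w
  proof -
    obtain x where "x \<in> \<Omega>" "F w = s *\<^sub>R x" using img [OF w] by blast
    then show ?thesis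
      using smult_mem [of "of_real s" x] s by (simp add: of_real_vector_smult)
  qed
  have it: "(F ^^ k) w \<in> \<Omega>" if "w \<in> \<Omega>" for k w
    by (induction k) (use that sub in auto)
  have sep: "separation_le ((F ^^ k) a) ((F ^^ k) b) (q ^ k)" if "a \<in> \<Omega>" "b \<in> \<Omega>" for a b k
  proof (induction k)
    case 0
    then show ?case using that by (simp add: separation_le_def)
  next
    case (Suc k)
    show ?case
      using separation_le_shrinking_map [OF F s img it [OF that(1)] Suc] by (simp add: q_def)
  qed
  have dist: "cmod ((F ^^ k) z $ j - (F ^^ n) z $ j) \<le> 2 * B * q ^ k" if "k \<le> n" for k n j
  proof -
    \<comment> \<open>The coordinate difference, scaled into the unit disk, is a test function for
      \<open>separation_le\<close> vanishing at the earlier iterate.\<close>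
    define f where "f w = (w $ j - (F ^^ k) z $ j) / (2 * B)" for w
    have "holo_on f \<Omega>"
      unfolding f_def by (intro holo_on_cdivide holo_on_diff holo_on_coord holo_on_const open_dom)
    moreover have "\<forall>w\<in>\<Omega>. cmod (f w) \<le> 1"
    proof
      fix w assume w: "w \<in> \<Omega>"
      have "cmod (w $ j - (F ^^ k) z $ j) \<le> cmod (w $ j) + cmod ((F ^^ k) z $ j)"
        by (rule norm_triangle_ineq4)
      also have "\<dots> \<le> B + B"
        using Finite_Cartesian_Product.norm_nth_le [of w j] Finite_Cartesian_Product.norm_nth_le [of "(F ^^ k) z" j]
          B(2) [OF w] B(2) [OF it [OF z, of k]] by linarith
      finally show "cmod (f w) \<le> 1"
        using B(1) by (simp add: f_def norm_divide norm_mult)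
    qed
    moreover have "f ((F ^^ k) z) = 0" by (simp add: f_def)
    moreover have "(F ^^ n) z = (F ^^ k) ((F ^^ (n - k)) z)"
      using funpow_add [of k "n - k" F] that by simp
    ultimately have "cmod (f ((F ^^ n) z)) \<le> q ^ k"
      using sep [OF z it [OF z], of k "n - k", unfolded separation_le_def, rule_format, of f] by simp
    then show ?thesis
      using B(1) by (simp add: f_def norm_divide norm_mult pos_divide_le_eq norm_minus_commute mult_ac)
  qed
  have "Cauchy (\<lambda>k. (F ^^ k) z $ j)" for j
  proof (rule CauchyI')
    fix e :: real assume e: "e > 0"
    have "(\<lambda>k. 2 * B * q ^ k) \<longlonglongrightarrow> 2 * B * 0"
      using q \<open>q < 1\<close> by (intro tendsto_intros LIMSEQ_power_zero) simp
    then have "eventually (\<lambda>k. 2 * B * q ^ k < e) sequentially"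
      using order_tendstoD(2) [of "\<lambda>k. 2 * B * q ^ k" 0 sequentially e] e by simp
    then obtain N where N: "\<And>k. k \<ge> N \<Longrightarrow> 2 * B * q ^ k < e"
      by (auto simp: eventually_sequentially)
    show "\<exists>M. \<forall>m\<ge>M. \<forall>n>m. dist ((F ^^ m) z $ j) ((F ^^ n) z $ j) < e"
    proof (intro exI [of _ N] allI impI)
      fix m n :: nat assume "N \<le> m" "m < n"
      then show "dist ((F ^^ m) z $ j) ((F ^^ n) z $ j) < e"
        using dist [of m n j] N [of m] by (simp add: dist_norm)
    qed
  qed
  then have "\<forall>j. \<exists>l. (\<lambda>k. (F ^^ k) z $ j) \<longlonglongrightarrow> l"
    using Cauchy_convergent convergent_def by blast
  from choice [OF this] obtain l where l: "\<And>j. (\<lambda>k. (F ^^ k) z $ j) \<longlonglongrightarrow> l j"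
    by blast
  define w where "w = (\<chi> j. l j)"
  have lim: "(\<lambda>k. (F ^^ k) z) \<longlonglongrightarrow> w"
    by (rule vec_tendstoI) (simp add: w_def l)
  have lim': "(\<lambda>k. F ((F ^^ k) z)) \<longlonglongrightarrow> w"
    using LIMSEQ_Suc [OF lim] by simp
  \<comment> \<open>All values of \<open>F\<close> lie in \<open>s\<close> times
    \<open>\<Omega>\<close>, so the limit lies in \<open>s\<close> times the closure, which is still
    inside \<open>\<Omega>\<close>.\<close>
  have "(1 / s) *\<^sub>R w \<in> closure \<Omega>"
  proof (rule Lim_in_closed_set [of _ "\<lambda>k. (1 / s) *\<^sub>R F ((F ^^ k) z)" sequentially])
    have "(1 / s) *\<^sub>R F x \<in> \<Omega>" if "x \<in> \<Omega>" for x
      using img [OF that] s by auto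
    then show "\<forall>\<^sub>F k in sequentially. (1 / s) *\<^sub>R F ((F ^^ k) z) \<in> closure \<Omega>"
      using it [OF z] closure_subset by (intro always_eventually) blast
    show "(\<lambda>k. (1 / s) *\<^sub>R F ((F ^^ k) z)) \<longlonglongrightarrow> (1 / s) *\<^sub>R w"
      by (intro tendsto_intros lim')
  qed auto
  from shrink_closure_mem [OF this, of s] s have w: "w \<in> \<Omega>"
    by simp
  have "isCont F w"
    using holo_map_on_continuous [OF F] open_dom w by (simp add: continuous_on_eq_continuous_at)
  from isCont_tendsto_compose [OF this lim] have "F w = w"
    using lim' LIMSEQ_unique by blast
  with w lim show thesis by (rule that)
qed

text \<open>The fixed point \<open>p\<close> keeps the limit map off the boundary. The last
  conclusion serves the polydisk, where \<open>R\<close> changes a single coordinate and the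
  retraction must do the same.\<close>

theorem retraction_onto_fixed_points:
  assumes R: "holo_map_on R \<Omega>" and R_dom: "R ` \<Omega> \<subseteq> \<Omega>" and p: "p \<in> \<Omega>" "R p = p"
  obtains \<rho> where "holo_map_on \<rho> \<Omega>" "\<rho> ` \<Omega> \<subseteq> \<Omega>"
    "\<And>z. z \<in> \<Omega> \<Longrightarrow> R (\<rho> z) = \<rho> z"
    "\<And>z. z \<in> \<Omega> \<Longrightarrow> R z = z \<Longrightarrow> \<rho> z = z"
    "\<And>j z. \<forall>w\<in>\<Omega>. R w $ j = w $ j \<Longrightarrow> z \<in> \<Omega> \<Longrightarrow> \<rho> z $ j = z $ j"
proof -
  obtain B where B: "\<And>w. w \<in> \<Omega> \<Longrightarrow> norm w \<le> B"
    using bounded_dom bounded_pos by blast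
  have step: "\<exists>\<theta>. holo_map_on \<theta> \<Omega> \<and> \<theta> ` \<Omega> \<subseteq> \<Omega> \<and>
      (\<forall>z\<in>\<Omega>. (1 - t) *\<^sub>R z + t *\<^sub>R R (\<theta> z) = \<theta> z) \<and> (\<forall>z\<in>\<Omega>. R z = z \<longrightarrow> \<theta> z = z)"
    if t: "0 < t" "t < 1" for t
  proof -
    define F where "F z w = (1 - t) *\<^sub>R z + t *\<^sub>R R w" for z w
    \<comment> \<open>Iterates of the contraction \<open>F z\<close> started at \<open>z\<close>
      itself: each \<open>W k\<close> is holomorphic in \<open>z\<close>, and so is their limit, a
      fixed point of \<open>F z\<close>.\<close>
    define W where "W k z = (F z ^^ k) z" for k z
    have F_dom: "F z w \<in> \<Omega>" if "z \<in> \<Omega>" "w \<in> \<Omega>" for z w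
      unfolding F_def using convex_dom that R_dom t by (intro convexD) auto
    have W_Suc: "W (Suc k) z = F z (W k z)" for k z
      by (simp add: W_def)
    have W_dom: "W k z \<in> \<Omega>" if "z \<in> \<Omega>" for k z
    proof (induction k)
      case 0
      then show ?case using that by (simp add: W_def)
    qed (simp add: W_Suc F_dom that)
    have hW: "holo_map_on (W k) \<Omega>" for k
    proof (induction k)
      case 0
      then show ?case
        by (simp add: W_def holo_map_on_def holo_on_coord open_dom)
    next
      case (Suc k)
      have RW: "holo_map_on (\<lambda>z. R (W k z)) \<Omega>"
        by (rule holo_map_on_compose [OF R Suc]) (use W_dom in auto)
      show ?case
        unfolding holo_map_on_def
      proof
        fix i
        have "holo_on (\<lambda>z. of_real (1 - t) * z $ i + of_real t * R (W k z) $ i) \<Omega>"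
          using RW unfolding holo_map_on_def
          by (intro holo_on_add holo_on_cmult holo_on_coord open_dom) auto
        then show "holo_on (\<lambda>z. W (Suc k) z $ i) \<Omega>"
          by (simp add: W_Suc F_def scaleR_conv_of_real [where 'a = complex])
      qed
    qed
    have "\<forall>z\<in>\<Omega>. \<exists>w. w \<in> \<Omega> \<and> (\<lambda>k. W k z) \<longlonglongrightarrow> w \<and> F z w = w"
    proof
      fix z assume z: "z \<in> \<Omega>"
      obtain s0 x where s0: "0 < s0" "s0 < 1" "x \<in> \<Omega>" "z = s0 *\<^sub>R x"
        using shrink_mem [OF z] .
      \<comment> \<open>With \<open>z = s0 *\<^sub>R x\<close>, each \<open>F z w\<close> is
        \<open>s\<close> times a convex combination of \<open>x\<close> and \<open>R w\<close>;
        hence \<open>F z\<close> maps into \<open>s\<close> times \<open>\<Omega>\<close>.\<close>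
      define s where "s = (1 - t) * s0 + t"
      have s: "0 < s" "s < 1"
      proof -
        have "(1 - t) * s0 > 0" using t s0 by simp
        then show "0 < s" using t by (simp add: s_def)
        have "(1 - t) * s0 < 1 - t" using t s0 by simp
        then show "s < 1" by (simp add: s_def)
      qed
      have "holo_map_on (F z) \<Omega>"
        unfolding holo_map_on_def
      proof
        fix i
        have "holo_on (\<lambda>w. of_real (1 - t) * z $ i + of_real t * R w $ i) \<Omega>"
          using R unfolding holo_map_on_def
          by (intro holo_on_add holo_on_cmult holo_on_const open_dom) auto
        then show "holo_on (\<lambda>w. F z w $ i) \<Omega>"
          by (simp add: F_def scaleR_conv_of_real [where 'a = complex])
      qed
      moreover have "\<exists>y\<in>\<Omega>. F z w = s *\<^sub>R y" if "w \<in> \<Omega>" for w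
      proof (rule bexI)
        have "((1 - t) * s0 / s) *\<^sub>R x + (t / s) *\<^sub>R R w \<in> \<Omega>"
          using s0 R_dom that t s
          by (intro convexD convex_dom) (auto simp: add_divide_distrib [symmetric] s_def)
        then show "((1 - t) * s0 / s) *\<^sub>R x + (t / s) *\<^sub>R R w \<in> \<Omega>" .
        show "F z w = s *\<^sub>R (((1 - t) * s0 / s) *\<^sub>R x + (t / s) *\<^sub>R R w)"
          using s by (simp add: F_def s0(4) scaleR_add_right)
      qed
      ultimately obtain w where "w \<in> \<Omega>" "(\<lambda>k. (F z ^^ k) z) \<longlonglongrightarrow> w" "F z w = w"
        by (rule shrinking_map_iterates [OF _ s _ z])
      then show "\<exists>w. w \<in> \<Omega> \<and> (\<lambda>k. W k z) \<longlonglongrightarrow> w \<and> F z w = w"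
        by (auto simp: W_def)
    qed
    from bchoice [OF this] obtain \<theta> where \<theta>: "\<forall>z\<in>\<Omega>. \<theta> z \<in> \<Omega> \<and> (\<lambda>k. W k z) \<longlonglongrightarrow> \<theta> z \<and> F z (\<theta> z) = \<theta> z"
      by blast
    have "holo_map_on \<theta> \<Omega>"
      by (rule holo_map_on_pointwise_limit [OF hW, where B = B]) (use \<theta> B W_dom in auto)
    moreover have "\<theta> z = z" if "z \<in> \<Omega>" "R z = z" for z
    proof -
      have "F z z = z" using that by (simp add: F_def algebra_simps)
      then have "W k z = z" for k
        by (induction k) (auto simp: W_def)
      then have "(\<lambda>k. W k z) \<longlonglongrightarrow> z" by simp
      then show ?thesis
        using \<theta> that LIMSEQ_unique by blast
    qed
    ultimately show ?thesis
      using \<theta> unfolding F_def by (intro exI [of _ \<theta>]) auto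
  qed
  \<comment> \<open>The double \<open>Suc\<close> excludes the value 0, so \<open>step\<close>
    applies for every \<open>n\<close>.\<close>
  define t where "t n = 1 - inverse (real (Suc (Suc n)))" for n
  have t: "0 < t n" "t n < 1" for n
    by (simp_all add: t_def inverse_eq_divide)
  have "\<forall>n. \<exists>\<theta>. holo_map_on \<theta> \<Omega> \<and> \<theta> ` \<Omega> \<subseteq> \<Omega> \<and>
      (\<forall>z\<in>\<Omega>. (1 - t n) *\<^sub>R z + t n *\<^sub>R R (\<theta> z) = \<theta> z) \<and> (\<forall>z\<in>\<Omega>. R z = z \<longrightarrow> \<theta> z = z)"
    using step t by blast
  from choice [OF this] obtain \<theta> where \<theta>: "\<And>n. holo_map_on (\<theta> n) \<Omega>" "\<And>n. \<theta> n ` \<Omega> \<subseteq> \<Omega>"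
      "\<And>n z. z \<in> \<Omega> \<Longrightarrow> (1 - t n) *\<^sub>R z + t n *\<^sub>R R (\<theta> n z) = \<theta> n z"
      "\<And>n z. z \<in> \<Omega> \<Longrightarrow> R z = z \<Longrightarrow> \<theta> n z = z"
    by blast
  have bd: "norm (\<theta> n z) \<le> B" if "z \<in> \<Omega>" for n z
    using B \<theta>(2) that by blast
  obtain k \<rho> where k: "strict_mono k" and \<rho>: "holo_map_on \<rho> \<Omega>" "\<And>z. z \<in> \<Omega> \<Longrightarrow> (\<lambda>n. \<theta> (k n) z) \<longlonglongrightarrow> \<rho> z"
    by (rule Montel_pointwise [of \<theta> \<Omega> B]) (use \<theta>(1) bd in blast)+
  have fix_R: "\<rho> z = z" if "z \<in> \<Omega>" "R z = z" for z
    using \<rho>(2) [OF that(1)] by (simp add: \<theta>(4) [OF that] LIMSEQ_const_iff)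
  have "\<rho> ` \<Omega> \<subseteq> \<Omega>"
  proof (rule maps_into_dom [OF \<rho>(1)])
    fix a b z assume le: "\<And>x. x \<in> \<Omega> \<Longrightarrow> cmod (cinner a x) \<le> b" and z: "z \<in> \<Omega>"
    have "\<rho> z \<in> closure \<Omega>"
    proof (rule Lim_in_closed_set [OF closed_closure _ _ \<rho>(2) [OF z]])
      show "\<forall>\<^sub>F n in sequentially. \<theta> (k n) z \<in> closure \<Omega>"
        using \<theta>(2) z closure_subset by (intro always_eventually) blast
    qed simp
    with le show "cmod (cinner a (\<rho> z)) \<le> b"
      by (rule closure_norm_cinner_le)
  next
    show "p \<in> \<Omega>" "\<rho> p \<in> \<Omega>" using p fix_R [OF p] by auto
  qed
  have "t \<longlonglongrightarrow> 1"
    unfolding t_def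
    using tendsto_diff [OF tendsto_const LIMSEQ_Suc [OF LIMSEQ_inverse_real_of_nat], of 1] by simp
  then have tk: "(\<lambda>n. t (k n)) \<longlonglongrightarrow> 1"
    using LIMSEQ_subseq_LIMSEQ [OF _ k] by (simp add: o_def)
  \<comment> \<open>Letting the parameter tend to 1 in the fixed point equation removes the term
    with \<open>z\<close>.\<close>
  have R\<rho>: "R (\<rho> z) = \<rho> z" if z: "z \<in> \<Omega>" for z
  proof -
    have "isCont R (\<rho> z)"
      using holo_map_on_continuous [OF R] open_dom z \<open>\<rho> ` \<Omega> \<subseteq> \<Omega>\<close> by (auto simp: continuous_on_eq_continuous_at)
    then have "(\<lambda>n. R (\<theta> (k n) z)) \<longlonglongrightarrow> R (\<rho> z)"
      by (rule isCont_tendsto_compose [OF _ \<rho>(2) [OF z]])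
    then have "(\<lambda>n. (1 - t (k n)) *\<^sub>R z + t (k n) *\<^sub>R R (\<theta> (k n) z)) \<longlonglongrightarrow> (1 - 1) *\<^sub>R z + 1 *\<^sub>R R (\<rho> z)"
      by (intro tendsto_intros tk)
    then have "(\<lambda>n. \<theta> (k n) z) \<longlonglongrightarrow> R (\<rho> z)"
      by (simp add: \<theta>(3) [OF z])
    then show ?thesis
      using \<rho>(2) [OF z] LIMSEQ_unique by blast
  qed
  have coord: "\<rho> z $ j = z $ j" if Rj: "\<forall>w\<in>\<Omega>. R w $ j = w $ j" and z: "z \<in> \<Omega>" for j z
  proof -
    have "\<theta> n z $ j = z $ j" for n
    proof -
      have "\<theta> n z \<in> \<Omega>" using \<theta>(2) z by blast
      then have "(1 - t n) *\<^sub>R z $ j + t n *\<^sub>R \<theta> n z $ j = \<theta> n z $ j"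
        using arg_cong [OF \<theta>(3) [OF z, of n], of "\<lambda>w. w $ j"] Rj by simp
      then have "(1 - t n) *\<^sub>R (z $ j) = (1 - t n) *\<^sub>R (\<theta> n z $ j)"
        by (simp add: algebra_simps)
      then show ?thesis using t [of n] by simp
    qed
    moreover have "(\<lambda>n. \<theta> (k n) z $ j) \<longlonglongrightarrow> \<rho> z $ j"
      by (intro tendsto_intros \<rho>(2) z)
    ultimately show ?thesis
      by (simp add: LIMSEQ_const_iff)
  qed
  show thesis
    by (rule that [OF \<rho>(1) \<open>\<rho> ` \<Omega> \<subseteq> \<Omega>\<close> R\<rho> fix_R coord])
qed

end

section \<open>Isometric extension operators\<close>

lemma holo_var_open_imp_holo_on:
  assumes "open \<Omega>" "holo_var f \<Omega>"
  shows "holo_on f \<Omega>"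
proof (rule holo_on_local)
  fix z assume "z \<in> \<Omega>"
  then obtain U g where U: "open U" "z \<in> U" "holo_on g U" "\<forall>x\<in>\<Omega> \<inter> U. f x = g x"
    using assms(2) unfolding holo_var_def by blast
  have "holo_on f (\<Omega> \<inter> U)"
    by (rule holo_on_cong_open [OF U(3)]) (use U assms in auto)
  then show "\<exists>W. z \<in> W \<and> W \<subseteq> \<Omega> \<and> holo_on f W"
    using \<open>z \<in> \<Omega>\<close> U(2) by blast
qed

text \<open>Unlike \<open>Hinf\<close>, this prescribes nothing outside \<open>U\<close>, so
  polynomials and constants qualify as they stand.\<close>

definition bounded_holo_on :: "(complex^'n \<Rightarrow> complex) \<Rightarrow> (complex^'n) set \<Rightarrow> bool" where
  "bounded_holo_on f U \<longleftrightarrow> holo_on f U \<and> (\<exists>B. \<forall>x\<in>U. cmod (f x) \<le> B)"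

lemma bounded_holo_on_add:
  assumes "bounded_holo_on f U" "bounded_holo_on g U"
  shows "bounded_holo_on (\<lambda>x. f x + g x) U"
proof -
  obtain B C where BC: "\<forall>x\<in>U. cmod (f x) \<le> B" "\<forall>x\<in>U. cmod (g x) \<le> C"
    using assms by (auto simp: bounded_holo_on_def)
  have "\<forall>x\<in>U. cmod (f x + g x) \<le> B + C"
    using BC by (intro ballI norm_triangle_le add_mono) auto
  then show ?thesis
    using assms holo_on_add [of f U g] unfolding bounded_holo_on_def by blast
qed

lemma bounded_holo_on_mult:
  assumes "bounded_holo_on f U" "bounded_holo_on g U"
  shows "bounded_holo_on (\<lambda>x. f x * g x) U"
proof -
  obtain B C where BC: "\<forall>x\<in>U. cmod (f x) \<le> B" "\<forall>x\<in>U. cmod (g x) \<le> C"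
    using assms by (auto simp: bounded_holo_on_def)
  have "\<forall>x\<in>U. cmod (f x * g x) \<le> \<bar>B\<bar> * C"
    unfolding norm_mult using BC by (intro ballI mult_mono) auto
  then show ?thesis
    using assms holo_on_mult [of f U g] unfolding bounded_holo_on_def by blast
qed

lemma bounded_holo_on_const: "open U \<Longrightarrow> bounded_holo_on (\<lambda>x. c) U"
  unfolding bounded_holo_on_def by (auto intro: holo_on_const)

lemma bounded_holo_on_cmult: "bounded_holo_on f U \<Longrightarrow> bounded_holo_on (\<lambda>x. c * f x) U"
  by (rule bounded_holo_on_mult [OF bounded_holo_on_const])
    (auto simp: bounded_holo_on_def holo_on_def)

lemma bounded_holo_on_diff:
  "bounded_holo_on f U \<Longrightarrow> bounded_holo_on g U \<Longrightarrow> bounded_holo_on (\<lambda>x. f x - g x) U"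
  using bounded_holo_on_add [of f U "\<lambda>x. -1 * g x", OF _ bounded_holo_on_cmult] by simp

lemma bounded_holo_on_compose:
  assumes "bounded_holo_on g W" "holo_map_on F U" "F ` U \<subseteq> W"
  shows "bounded_holo_on (\<lambda>z. g (F z)) U"
  using assms holo_on_compose [OF _ assms(2,3)] unfolding bounded_holo_on_def by blast

lemma bounded_holo_on_poly:
  assumes "poly_fun p" "open U" "bounded U"
  shows "bounded_holo_on p U"
proof -
  have "continuous_on (closure U) p"
    using holo_on_continuous [OF holo_on_poly [OF assms(1) open_UNIV]] by (rule continuous_on_subset) simp
  then have "compact (p ` closure U)"
    using assms(3) by (intro compact_continuous_image) (simp_all add: compact_closure)
  then obtain B where B: "\<forall>x\<in>closure U. cmod (p x) \<le> B"
    by (auto dest!: compact_imp_bounded simp: bounded_iff)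
  then have "\<forall>x\<in>U. cmod (p x) \<le> B"
    using closure_subset [of U] by blast
  then show ?thesis
    using holo_on_poly [OF assms(1,2)] unfolding bounded_holo_on_def by blast
qed

definition restrict0 :: "(complex^'n) set \<Rightarrow> (complex^'n \<Rightarrow> complex) \<Rightarrow> complex^'n \<Rightarrow> complex" where
  "restrict0 V f = (\<lambda>x. if x \<in> V then f x else 0)"

lemma restrict0_Hinf:
  assumes "bounded_holo_on f U" "V \<subseteq> U"
  shows "restrict0 V f \<in> Hinf V"
  unfolding Hinf_def
proof (intro CollectI conjI allI impI)
  show "holo_var (restrict0 V f) V"
    unfolding holo_var_def
  proof
    fix \<mu> assume "\<mu> \<in> V"
    then show "\<exists>W g. open W \<and> \<mu> \<in> W \<and> holo_on g W \<and> (\<forall>x\<in>V \<inter> W. restrict0 V f x = g x)"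
      using assms by (intro exI [of _ U] exI [of _ f]) (auto simp: bounded_holo_on_def holo_on_open restrict0_def)
  qed
  obtain B where "\<forall>x\<in>U. cmod (f x) \<le> B"
    using assms by (auto simp: bounded_holo_on_def)
  then show "bounded (restrict0 V f ` V)"
    using assms(2) by (intro boundedI [of _ B]) (auto simp: restrict0_def)
qed (simp add: restrict0_def)

lemma Hinf_bounded: "f \<in> Hinf V \<Longrightarrow> bdd_above ((\<lambda>x. cmod (f x)) ` V)"
  by (auto simp: Hinf_def bounded_iff intro: bdd_aboveI2)

locale isometric_extension = balanced_convex_domain \<Omega> for \<Omega> :: "(complex^'n) set" +
  fixes V :: "(complex^'n) set" and E :: "(complex^'n \<Rightarrow> complex) \<Rightarrow> (complex^'n \<Rightarrow> complex)"
  assumes V_sub: "V \<subseteq> \<Omega>" and V_ne: "V \<noteq> {}"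
    and E_maps: "\<And>f. f \<in> Hinf V \<Longrightarrow> E f \<in> Hinf \<Omega>"
    and E_add: "\<And>f g. f \<in> Hinf V \<Longrightarrow> g \<in> Hinf V \<Longrightarrow> E (\<lambda>x. f x + g x) = (\<lambda>x. E f x + E g x)"
    and E_smult: "\<And>f c. f \<in> Hinf V \<Longrightarrow> E (\<lambda>x. c * f x) = (\<lambda>x. c * E f x)"
    and E_ext: "\<And>f x. f \<in> Hinf V \<Longrightarrow> x \<in> V \<Longrightarrow> E f x = f x"
    and E_isom: "\<And>f. f \<in> Hinf V \<Longrightarrow> (SUP x\<in>\<Omega>. cmod (E f x)) = (SUP x\<in>V. cmod (f x))"
    and poly_convex: "rel_poly_convex V \<Omega>"
begin

text \<open>The operator \<open>E\<close> as applied to functions given on all of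
  \<open>\<Omega>\<close>, such as polynomials; by \<open>extension_cong\<close> only their values
  on \<open>V\<close> matter.\<close>

definition extension :: "(complex^'n \<Rightarrow> complex) \<Rightarrow> complex^'n \<Rightarrow> complex" where
  "extension f = E (restrict0 V f)"

lemmas res_Hinf = restrict0_Hinf [OF _ V_sub]

lemma bh_poly: "poly_fun p \<Longrightarrow> bounded_holo_on p \<Omega>"
  by (rule bounded_holo_on_poly [OF _ open_dom bounded_dom])

lemma extension_add:
  assumes "bounded_holo_on f \<Omega>" "bounded_holo_on g \<Omega>"
  shows "extension (\<lambda>x. f x + g x) z = extension f z + extension g z"
proof -
  have "restrict0 V (\<lambda>x. f x + g x) = (\<lambda>x. restrict0 V f x + restrict0 V g x)"
    by (auto simp: restrict0_def)
  then show ?thesis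
    using E_add [OF res_Hinf [OF assms(1)] res_Hinf [OF assms(2)]] by (simp add: extension_def)
qed

lemma extension_cmult:
  assumes "bounded_holo_on f \<Omega>"
  shows "extension (\<lambda>x. c * f x) z = c * extension f z"
proof -
  have "restrict0 V (\<lambda>x. c * f x) = (\<lambda>x. c * restrict0 V f x)"
    by (auto simp: restrict0_def)
  then show ?thesis
    using E_smult [OF res_Hinf [OF assms]] by (simp add: extension_def)
qed

lemma extension_diff:
  assumes "bounded_holo_on f \<Omega>" "bounded_holo_on g \<Omega>"
  shows "extension (\<lambda>x. f x - g x) z = extension f z - extension g z"
  using extension_add [OF assms(1) bounded_holo_on_cmult [OF assms(2), of "-1"], of z] extension_cmult [OF assms(2), of "-1" z]
  by simp

lemma extension_holo: "bounded_holo_on f \<Omega> \<Longrightarrow> holo_on (extension f) \<Omega>"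
  using E_maps [OF res_Hinf] open_dom holo_var_open_imp_holo_on unfolding extension_def Hinf_def by blast

lemma extension_ext: "bounded_holo_on f \<Omega> \<Longrightarrow> x \<in> V \<Longrightarrow> extension f x = f x"
  using E_ext [OF res_Hinf] by (simp add: extension_def restrict0_def)

lemma extension_cong: "(\<And>x. x \<in> V \<Longrightarrow> f x = g x) \<Longrightarrow> extension f = extension g"
proof -
  assume "\<And>x. x \<in> V \<Longrightarrow> f x = g x"
  then have "restrict0 V f = restrict0 V g" by (auto simp: restrict0_def)
  then show ?thesis by (simp add: extension_def)
qed

lemma extension_le_SUP:
  assumes f: "bounded_holo_on f \<Omega>" and z: "z \<in> \<Omega>"
  shows "cmod (extension f z) \<le> (SUP x\<in>V. cmod (f x))"
proof -
  note H = res_Hinf [OF f]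
  have "cmod (extension f z) \<le> (SUP x\<in>\<Omega>. cmod (extension f x))"
    using Hinf_bounded [OF E_maps [OF H]] z unfolding extension_def by (rule cSUP_upper2) simp
  also have "\<dots> = (SUP x\<in>V. cmod (f x))"
    using E_isom [OF H] by (simp add: extension_def restrict0_def)
  finally show ?thesis .
qed

lemma extension_le:
  assumes "bounded_holo_on f \<Omega>" "\<And>x. x \<in> V \<Longrightarrow> cmod (f x) \<le> M" "z \<in> \<Omega>"
  shows "cmod (extension f z) \<le> M"
  using extension_le_SUP [OF assms(1,3)] cSUP_least [OF V_ne, of "\<lambda>x. cmod (f x)" M] assms(2) by simp

text \<open>Isometry bounds the modulus by 1, a value attained at points of \<open>V\<close>, so the
  maximum principle forces a constant.\<close>

lemma extension_one: "z \<in> \<Omega> \<Longrightarrow> extension (\<lambda>x. 1) z = 1"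
proof -
  assume z: "z \<in> \<Omega>"
  note h = bounded_holo_on_const [OF open_dom, of 1]
  obtain v where v: "v \<in> V" using V_ne by blast
  have 1: "extension (\<lambda>x. 1) v = 1" using extension_ext [OF h v] .
  have "extension (\<lambda>x. 1) z = extension (\<lambda>x. 1) v"
    by (rule holo_on_max_modulus [OF extension_holo [OF h] convex_dom]) (use v V_sub z 1 extension_le [OF h] in auto)
  with 1 show ?thesis by simp
qed

lemma extension_const: "z \<in> \<Omega> \<Longrightarrow> extension (\<lambda>x. c) z = c"
  using extension_cmult [OF bounded_holo_on_const [OF open_dom, of 1], of c z] extension_one [of z] by simp

definition coord_map :: "complex^'n \<Rightarrow> complex^'n" where
  "coord_map z = (\<chi> i. extension (\<lambda>x. x $ i) z)"

lemma coord_map_holo: "holo_map_on coord_map \<Omega>"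
  unfolding holo_map_on_def coord_map_def by (simp add: extension_holo bh_poly poly_fun.coord)

lemma coord_map_fix: "x \<in> V \<Longrightarrow> coord_map x = x"
  by (simp add: coord_map_def vec_eq_iff extension_ext bh_poly poly_fun.coord)

lemma extension_sum:
  assumes "finite I" "\<And>i. i \<in> I \<Longrightarrow> bounded_holo_on (f i) \<Omega>" "z \<in> \<Omega>"
  shows "bounded_holo_on (\<lambda>x. \<Sum>i\<in>I. f i x) \<Omega> \<and> extension (\<lambda>x. \<Sum>i\<in>I. f i x) z = (\<Sum>i\<in>I. extension (f i) z)"
  using assms
proof (induction I rule: finite_induct)
  case empty
  then show ?case by (simp add: extension_const bounded_holo_on_const open_dom)
next
  case (insert i I)
  then have "bounded_holo_on (f i) \<Omega>" "bounded_holo_on (\<lambda>x. \<Sum>i\<in>I. f i x) \<Omega>"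
    and "extension (\<lambda>x. \<Sum>i\<in>I. f i x) z = (\<Sum>i\<in>I. extension (f i) z)" by auto
  then show ?case
    using bounded_holo_on_add [of "f i" \<Omega> "\<lambda>x. \<Sum>i\<in>I. f i x"] extension_add [of "f i" "\<lambda>x. \<Sum>i\<in>I. f i x" z] insert.hyps
    by simp
qed

lemma extension_cinner:
  assumes "z \<in> \<Omega>"
  shows "extension (cinner a) z = cinner a (coord_map z)"
proof -
  have "extension (cinner a) z = (\<Sum>i\<in>UNIV. extension (\<lambda>x. cnj (a $ i) * x $ i) z)"
    unfolding cinner_def [abs_def]
    using extension_sum [OF finite, of UNIV "\<lambda>i x. cnj (a $ i) * x $ i" z] assms
    by (simp add: bounded_holo_on_cmult bh_poly poly_fun.coord)
  also have "\<dots> = cinner a (coord_map z)"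
    by (simp add: cinner_def coord_map_def extension_cmult bh_poly poly_fun.coord)
  finally show ?thesis .
qed

text \<open>Isometry lets every linear functional of \<open>coord_map z\<close> inherit its bound on
  \<open>\<Omega>\<close>; a point of \<open>V\<close>, being fixed, rules out boundary
  values.\<close>

lemma coord_map_dom: "coord_map ` \<Omega> \<subseteq> \<Omega>"
proof -
  obtain v where v: "v \<in> V" using V_ne by blast
  show ?thesis
  proof (rule maps_into_dom [OF coord_map_holo, of v])
    fix a b z assume "\<And>x. x \<in> \<Omega> \<Longrightarrow> cmod (cinner a x) \<le> b" "z \<in> \<Omega>"
    then show "cmod (cinner a (coord_map z)) \<le> b"
      using extension_le [OF bh_poly [OF poly_fun_cinner], of a b z] V_sub by (auto simp: extension_cinner)
  qed (use v V_sub coord_map_fix in auto)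
qed

lemma retract_if_poly_bound:
  assumes "holo_map_on \<psi> \<Omega>" "\<psi> ` \<Omega> \<subseteq> \<Omega>" "\<And>x. x \<in> V \<Longrightarrow> \<psi> x = x"
    and le: "\<And>p z. poly_fun p \<Longrightarrow> z \<in> \<Omega> \<Longrightarrow> cmod (p (\<psi> z)) \<le> (SUP x\<in>V. cmod (p x))"
  shows "retract_of_dom V \<Omega>"
proof -
  have "\<psi> z \<in> V" if z: "z \<in> \<Omega>" for z
  proof (rule ccontr)
    assume "\<psi> z \<notin> V"
    then have "\<psi> z \<in> \<Omega> - V" using assms(2) z by blast
    then obtain p where "poly_fun p" "cmod (p (\<psi> z)) > (SUP x\<in>V. cmod (p x))"
      using poly_convex unfolding rel_poly_convex_def by blast
    then show False
      using le [of p z] z by simp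
  qed
  moreover have "V \<subseteq> \<psi> ` \<Omega>"
  proof
    fix x assume x: "x \<in> V"
    then have "x = \<psi> x" "x \<in> \<Omega>" using assms(3) V_sub by auto
    then show "x \<in> \<psi> ` \<Omega>" by (rule image_eqI)
  qed
  ultimately show ?thesis
    unfolding retract_of_dom_def using assms(1,3) by (intro exI [of _ \<psi>]) blast
qed

lemma retract_if_multiplicative:
  assumes mult: "\<And>f g. f \<in> Hinf V \<Longrightarrow> g \<in> Hinf V \<Longrightarrow> E (\<lambda>x. f x * g x) = (\<lambda>x. E f x * E g x)"
  shows "retract_of_dom V \<Omega>"
proof (rule retract_if_poly_bound [OF coord_map_holo coord_map_dom coord_map_fix])
  fix p :: "complex^'n \<Rightarrow> complex" and z
  assume p: "poly_fun p" and z: "z \<in> \<Omega>"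
  \<comment> \<open>Only the product case uses multiplicativity; the others rest on linearity and
    \<open>extension_const\<close>.\<close>
  have "extension p z = p (coord_map z)"
    using p
  proof induction
    case (mult p q)
    have "restrict0 V (\<lambda>x. p x * q x) = (\<lambda>x. restrict0 V p x * restrict0 V q x)"
      by (auto simp: restrict0_def)
    then have "extension (\<lambda>x. p x * q x) z = extension p z * extension q z"
      using assms [OF res_Hinf [OF bh_poly] res_Hinf [OF bh_poly]] mult.hyps by (simp add: extension_def)
    then show ?case by (simp add: mult.IH)
  qed (auto simp: extension_const z coord_map_def extension_add bh_poly)
  then show "cmod (p (coord_map z)) \<le> (SUP x\<in>V. cmod (p x))"
    using extension_le_SUP [OF bh_poly [OF p] z] by simp
qed

text \<open>The function \<open>cinner a x + b\<close> peaks at \<open>y\<close>: on the closure of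
  \<open>\<Omega>\<close> its modulus reaches \<open>2 * b\<close> only there. At fixed points of
  \<open>coord_map\<close> it equals its extension, so on them it is bounded by its maximum over
  \<open>closure V\<close>. If \<open>y\<close> were not in \<open>closure V\<close>, that maximum
  would stay below \<open>2 * b\<close>.\<close>

lemma closure_fixed_points_frontier:
  assumes sc: "strictly_convex \<Omega>" and y: "y \<in> frontier \<Omega>" "y \<in> closure {z \<in> \<Omega>. coord_map z = z}"
  shows "y \<in> closure V"
proof (rule ccontr)
  assume nV: "y \<notin> closure V"
  obtain a b where ab: "a \<noteq> 0" "{x. a \<bullet> x = b} \<inter> closure \<Omega> = {y}"
    using sc y(1) unfolding strictly_convex_def by blast
  have y_notin: "y \<notin> \<Omega>"
    using y(1) open_dom by (simp add: frontier_def interior_open)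
  \<comment> \<open>Connectedness keeps \<open>\<Omega>\<close> on one side of the hyperplane; a
    change of signs makes it the side \<open>a \<bullet> x \<le> b\<close>.\<close>
  have "\<exists>a b. a \<noteq> 0 \<and> (\<forall>x\<in>\<Omega>. a \<bullet> x \<le> b) \<and> {x. a \<bullet> x = b} \<inter> closure \<Omega> = {y}"
  proof -
    have con: "connected ((\<lambda>x. a \<bullet> x) ` \<Omega>)"
      by (intro connected_continuous_image continuous_intros convex_connected convex_dom)
    have "b \<notin> (\<lambda>x. a \<bullet> x) ` \<Omega>"
    proof
      assume "b \<in> (\<lambda>x. a \<bullet> x) ` \<Omega>"
      then obtain x where "x \<in> \<Omega>" "a \<bullet> x = b" by blast
      then have "x \<in> {x. a \<bullet> x = b} \<inter> closure \<Omega>" using closure_subset [of \<Omega>] by blast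
      then have "x = y" unfolding ab(2) by simp
      then show False using \<open>x \<in> \<Omega>\<close> y_notin by simp
    qed
    have "(\<forall>x\<in>\<Omega>. a \<bullet> x \<le> b) \<or> (\<forall>x\<in>\<Omega>. a \<bullet> x \<ge> b)"
    proof (rule ccontr)
      assume "\<not> ?thesis"
      then obtain x x' where "x \<in> \<Omega>" "x' \<in> \<Omega>" "b \<le> a \<bullet> x" "a \<bullet> x' \<le> b" by force
      then have "b \<in> (\<lambda>x. a \<bullet> x) ` \<Omega>"
        using con [unfolded connected_iff_interval, rule_format, of "a \<bullet> x'" "a \<bullet> x" b] by simp
      with \<open>b \<notin> _\<close> show False by blast
    qed
    then show ?thesis
    proof
      assume "\<forall>x\<in>\<Omega>. a \<bullet> x \<ge> b"
      then show ?thesis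
        using ab by (intro exI [of _ "- a"] exI [of _ "- b"]) auto
    qed (use ab in blast)
  qed
  then obtain a b where ab: "a \<noteq> 0" "\<And>x. x \<in> \<Omega> \<Longrightarrow> a \<bullet> x \<le> b" "{x. a \<bullet> x = b} \<inter> closure \<Omega> = {y}"
    by blast
  have le: "cmod (cinner a x) \<le> b" if "x \<in> closure \<Omega>" for x
  proof (rule closure_norm_cinner_le [OF _ that])
    show "cmod (cinner a x) \<le> b" if "x \<in> \<Omega>" for x
      using ab(2) that by (rule norm_cinner_le)
  qed
  have b: "b \<ge> 0" using ab(2) [OF zero_mem] by simp
  have eq_b: "cinner a x = b \<Longrightarrow> x = y" if "x \<in> closure \<Omega>" for x
  proof -
    assume "cinner a x = b"
    then have "x \<in> {x. a \<bullet> x = b} \<inter> closure \<Omega>" using that Re_cinner [of a x] by simp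
    then show "x = y" unfolding ab(3) by simp
  qed
  have lt: "cmod (cinner a x + b) < 2 * b" if "x \<in> closure V" for x
  proof (rule ccontr)
    assume "\<not> cmod (cinner a x + b) < 2 * b"
    moreover have x: "x \<in> closure \<Omega>" using that closure_mono [OF V_sub] by blast
    ultimately have 1: "2 * b \<le> cmod (cinner a x + b)" by simp
    \<comment> \<open>The parallelogram law: \<open>cmod (cinner a x) \<le> b\<close> together with
      \<open>2 * b \<le> cmod (cinner a x + b)\<close> leaves no room for
      \<open>cinner a x - b\<close>.\<close>
    define X where "X = Re (cinner a x)"
    have "(cmod (cinner a x))\<^sup>2 \<le> b\<^sup>2"
      using le [OF x] by (intro power_mono) auto
    moreover have "(2 * b)\<^sup>2 \<le> (cmod (cinner a x + b))\<^sup>2"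
      using 1 b by (intro power_mono) auto
    moreover have "(cmod (cinner a x + b))\<^sup>2 = (cmod (cinner a x))\<^sup>2 + b\<^sup>2 + 2 * b * X"
      unfolding cmod_power2 X_def by (simp add: power2_eq_square algebra_simps)
    moreover have "(cmod (cinner a x - b))\<^sup>2 = (cmod (cinner a x))\<^sup>2 + b\<^sup>2 - 2 * b * X"
      unfolding cmod_power2 X_def by (simp add: power2_eq_square algebra_simps)
    moreover have "(2 * b)\<^sup>2 = 4 * b\<^sup>2" by simp
    ultimately have "(cmod (cinner a x - b))\<^sup>2 \<le> 0"
      by linarith
    then have "cinner a x = b" by simp
    then show False using eq_b [OF x] nV that by blast
  qed
  have cont: "continuous_on S (\<lambda>x. cmod (cinner a x + b))" for S
    unfolding cinner_def by (intro continuous_intros)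
  have "compact (closure V)"
    using bounded_subset [OF bounded_dom V_sub] compact_closure by blast
  moreover have "closure V \<noteq> {}" using V_ne by simp
  ultimately obtain x0 where x0: "x0 \<in> closure V" "\<And>x. x \<in> closure V \<Longrightarrow> cmod (cinner a x + b) \<le> cmod (cinner a x0 + b)"
    using continuous_attains_sup [OF _ _ cont] by blast
  define m where "m = cmod (cinner a x0 + b)"
  have bh: "bounded_holo_on (\<lambda>x. cinner a x + b) \<Omega>"
    by (intro bh_poly poly_fun.add poly_fun_cinner poly_fun.const)
  have "cmod (cinner a z + b) \<le> m" if "z \<in> {z \<in> \<Omega>. coord_map z = z}" for z
  proof -
    have "cmod (extension (\<lambda>x. cinner a x + b) z) \<le> m"
      using that x0(2) closure_subset unfolding m_def by (intro extension_le [OF bh]) auto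
    moreover have "extension (\<lambda>x. cinner a x + b) z = cinner a z + b"
      using that extension_add [OF bh_poly [OF poly_fun_cinner] bounded_holo_on_const [OF open_dom], of a b z]
      by (simp add: extension_cinner extension_const)
    ultimately show ?thesis by simp
  qed
  then have "cmod (cinner a y + b) \<le> m"
    using continuous_le_on_closure [OF cont y(2)] by blast
  also have "m < 2 * b" using lt x0(1) by (simp add: m_def)
  finally have "cmod (cinner a y + b) < 2 * b" .
  moreover have "cinner a y = b"
  proof -
    have yb: "y \<in> closure \<Omega>" "Re (cinner a y) = b"
    proof -
      have "y \<in> {x. a \<bullet> x = b} \<inter> closure \<Omega>" unfolding ab(3) by simp
      then show "y \<in> closure \<Omega>" "Re (cinner a y) = b" by (simp_all add: Re_cinner)
    qed
    \<comment> \<open>Modulus at most \<open>b\<close> and real part equal to \<open>b\<close> leave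
      no imaginary part.\<close>
    have "(cmod (cinner a y))\<^sup>2 \<le> b\<^sup>2"
      using le [OF yb(1)] by (intro power_mono) auto
    then have "Im (cinner a y) = 0"
      using yb(2) by (simp add: cmod_power2)
    with yb(2) show ?thesis by (simp add: complex_eq_iff)
  qed
  ultimately show False using b by simp
qed

text \<open>Maximise the modulus of \<open>p\<close> over the closure of \<open>M\<close>. At a
  maximum inside \<open>\<Omega>\<close> the composite of \<open>p\<close> with
  \<open>\<rho>\<close> is constant, so its value is \<open>p v\<close>; a maximum on the frontier
  lies in \<open>closure V\<close>.\<close>

lemma retract_if_strictly_convex:
  assumes sc: "strictly_convex \<Omega>"
  shows "retract_of_dom V \<Omega>"
proof -
  obtain v where v: "v \<in> V" using V_ne by blast
  then have v': "v \<in> \<Omega>" "coord_map v = v" using V_sub coord_map_fix by auto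
  obtain \<rho> where \<rho>: "holo_map_on \<rho> \<Omega>" "\<rho> ` \<Omega> \<subseteq> \<Omega>" "\<And>z. z \<in> \<Omega> \<Longrightarrow> coord_map (\<rho> z) = \<rho> z"
    "\<And>z. z \<in> \<Omega> \<Longrightarrow> coord_map z = z \<Longrightarrow> \<rho> z = z"
    "\<And>j z. \<forall>w\<in>\<Omega>. coord_map w $ j = w $ j \<Longrightarrow> z \<in> \<Omega> \<Longrightarrow> \<rho> z $ j = z $ j"
    by (rule retraction_onto_fixed_points [OF coord_map_holo coord_map_dom v'], rule that) blast+
  define M where "M = {z \<in> \<Omega>. coord_map z = z}"
  have \<rho>M: "\<rho> z \<in> M" if "z \<in> \<Omega>" for z
    using \<rho> that by (auto simp: M_def)
  show ?thesis
  proof (rule retract_if_poly_bound [OF \<rho>(1,2)])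
    show "\<rho> x = x" if "x \<in> V" for x
      using \<rho>(4) coord_map_fix V_sub that by blast
    fix p :: "complex^'n \<Rightarrow> complex" and z
    assume p: "poly_fun p" and z: "z \<in> \<Omega>"
    have cont: "continuous_on S (\<lambda>x. cmod (p x))" for S
      by (intro continuous_intros continuous_on_subset [OF holo_on_continuous [OF holo_on_poly [OF p open_UNIV]]]) simp
    have "compact (closure M)"
      unfolding compact_closure by (rule bounded_subset [OF bounded_dom]) (auto simp: M_def)
    moreover have "closure M \<noteq> {}" using \<rho>M [OF z] closure_subset by blast
    ultimately obtain y where y: "y \<in> closure M" "\<And>x. x \<in> closure M \<Longrightarrow> cmod (p x) \<le> cmod (p y)"
      using continuous_attains_sup [OF _ _ cont] by blast
    have up: "cmod (p x) \<le> (SUP x\<in>V. cmod (p x))" if "x \<in> V" for x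
      using extension_le_SUP [OF bh_poly [OF p], of x] extension_ext [OF bh_poly [OF p] that] V_sub that by auto
    have "cmod (p y) \<le> (SUP x\<in>V. cmod (p x))"
    proof (cases "y \<in> \<Omega>")
      case True
      have "coord_map y = y"
      proof -
        have cr: "continuous_on \<Omega> (\<lambda>z. coord_map z - z)"
          by (intro continuous_intros holo_map_on_continuous coord_map_holo)
        obtain x where x: "\<And>n. x n \<in> M" "x \<longlonglongrightarrow> y"
          using y(1) closure_sequential by blast
        have "(\<lambda>n. coord_map (x n) - x n) \<longlonglongrightarrow> coord_map y - y"
          using cr True x by (intro continuous_on_tendsto_compose [OF cr x(2)]) (auto simp: M_def)
        then show ?thesis
          using x(1) by (simp add: M_def LIMSEQ_const_iff)
      qed
      then have \<rho>y: "\<rho> y = y" using \<rho>(4) True by blast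
      have "p (\<rho> v) = p (\<rho> y)"
      proof (rule holo_on_max_modulus [OF holo_on_compose [OF holo_on_poly [OF p open_dom] \<rho>(1,2)] convex_dom True _ v'(1)])
        show "cmod (p (\<rho> z)) \<le> cmod (p (\<rho> y))" if "z \<in> \<Omega>" for z
          using y(2) [OF subsetD [OF closure_subset \<rho>M [OF that]]] \<rho>y by simp
      qed
      then have "p y = p v" using \<rho>y \<rho>(4) v' by simp
      then show ?thesis using up [OF v] by simp
    next
      case False
      have "y \<in> closure \<Omega>" using y(1) closure_mono [of M \<Omega>] by (auto simp: M_def)
      then have "y \<in> frontier \<Omega>" using False open_dom by (simp add: frontier_def interior_open)
      then have "y \<in> closure V"
        using closure_fixed_points_frontier [OF sc] y(1) by (simp add: M_def)
      then show ?thesis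
        using continuous_le_on_closure [OF cont] up by blast
    qed
    then show "cmod (p (\<rho> z)) \<le> (SUP x\<in>V. cmod (p x))"
      using y(2) [OF subsetD [OF closure_subset \<rho>M [OF z]]] by linarith
  qed
qed

end

section \<open>Removable quotients\<close>

lemma holo_map_on_line_shift: "open U \<Longrightarrow> holo_map_on (\<lambda>z. z + a) U"
  unfolding holo_map_on_def
  by (simp add: holo_on_add holo_on_coord holo_on_const)

text \<open>Difference quotients along \<open>v\<close> converge pointwise and are bounded by the
  Lipschitz estimate, so \<open>holo_on_pointwise_limit\<close> applies.\<close>

lemma holo_on_directional_deriv:
  fixes f :: "complex^'n \<Rightarrow> complex"
  assumes f: "holo_on f U" and B: "\<And>x. x \<in> U \<Longrightarrow> cmod (f x) \<le> B"
  shows "holo_on (\<lambda>z. deriv (\<lambda>l. f (z + l *s v)) 0) U"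
proof (rule holo_on_local)
  fix z0 assume "z0 \<in> U"
  then obtain e where e: "e > 0" "ball z0 e \<subseteq> U"
    using holo_on_open [OF f] by (meson open_contains_ball)
  define d where "d = e / 2"
  have d: "d > 0" "ball z0 d \<subseteq> U"
    using e by (auto simp: d_def)
  have ball: "ball z d \<subseteq> U" if "z \<in> ball z0 d" for z
  proof
    fix x assume "x \<in> ball z d"
    then have "dist z0 x < e"
      using that dist_triangle [of z0 x z] by (simp add: d_def)
    then show "x \<in> U" using e by auto
  qed
  \<comment> \<open>\<open>N\<close> skips the first difference quotients, whose steps could be too
    long for the Lipschitz estimate.\<close>
  obtain N :: nat where N: "2 * norm v / d < real N"
    using reals_Archimedean2 by blast
  define m where "m n = real (Suc (n + N))" for n
  have m: "m n > 0" "norm v / m n \<le> d / 2" for n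
  proof -
    have "2 * norm v / d < m n" using N by (simp add: m_def)
    then have "2 * norm v < m n * d" using d by (simp add: pos_divide_less_eq)
    moreover show "m n > 0" by (simp add: m_def)
    ultimately show "norm v / m n \<le> d / 2" by (simp add: field_simps)
  qed
  define c where "c n = complex_of_real (1 / m n)" for n
  have nc: "norm (c n *s v) = norm v / m n" for n
    using m(1) [of n] by (simp add: c_def norm_vector_smult norm_divide)
  define F where "F n z = m n * (f (z + c n *s v) - f z)" for n z
  have "holo_on (\<lambda>z. deriv (\<lambda>l. f (z + l *s v)) 0) (ball z0 d)"
  proof (rule holo_on_pointwise_limit [of F _ "18 * B / d * norm v"])
    fix n
    have "(\<lambda>z. z + c n *s v) ` ball z0 d \<subseteq> U"
    proof (rule image_subsetI)
      fix z assume z: "z \<in> ball z0 d"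
      have "z + c n *s v \<in> ball z d"
      proof -
        have "norm (c n *s v) < d" using m(2) [of n] d(1) nc [of n] by linarith
        then show ?thesis by (simp add: dist_norm)
      qed
      then show "z + c n *s v \<in> U" using ball [OF z] by blast
    qed
    then show "holo_on (F n) (ball z0 d)"
      unfolding F_def using d
      by (intro holo_on_cmult holo_on_diff holo_on_compose [OF f holo_map_on_line_shift] holo_on_subset [OF f]) auto
    fix z assume z: "z \<in> ball z0 d"
    have "cmod (f (z + c n *s v) - f z) \<le> 18 * B / d * norm (c n *s v)"
      by (rule holo_on_locally_Lipschitz [OF f ball [OF z] d(1) B]) (use m in \<open>simp_all only: nc\<close>)
    also have "\<dots> = 18 * B / d * norm v / m n" by (simp add: nc)
    finally show "cmod (F n z) \<le> 18 * B / d * norm v"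
      using m(1) [of n] unfolding F_def norm_mult by (simp only: pos_le_divide_eq) (simp add: mult.commute)
  next
    fix z assume "z \<in> ball z0 d"
    then have "z \<in> U" using d by blast
    then obtain L where L: "(f has_derivative L) (at z)" "\<And>c v. L (c *s v) = c * L v"
      using f unfolding holo_on_def by blast
    have der: "((\<lambda>l. f (z + l *s v)) has_field_derivative L v) (at 0)"
      by (rule holo_on_line_deriv) (use L in auto)
    have c0: "c \<longlonglongrightarrow> 0"
    proof -
      have "(\<lambda>n. 1 / m n) \<longlonglongrightarrow> 0"
        using LIMSEQ_ignore_initial_segment [OF LIMSEQ_inverse_real_of_nat, of N]
        by (simp add: m_def inverse_eq_divide)
      then have "(\<lambda>n. complex_of_real (1 / m n)) \<longlonglongrightarrow> of_real 0"
        by (rule tendsto_of_real)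
      then show ?thesis by (simp add: c_def [abs_def])
    qed
    have cn: "c n \<noteq> 0" for n using m(1) [of n] by (simp add: c_def)
    have "filterlim c (at 0) sequentially"
      using c0 cn by (simp add: filterlim_at)
    from filterlim_compose [OF der [unfolded DERIV_def] this]
    have "(\<lambda>n. (f (z + c n *s v) - f z) / c n) \<longlonglongrightarrow> L v"
      by simp
    moreover have "(f (z + c n *s v) - f z) / c n = F n z" for n
      using m(1) [of n] by (simp add: c_def F_def)
    ultimately show "(\<lambda>n. F n z) \<longlonglongrightarrow> deriv (\<lambda>l. f (z + l *s v)) 0"
      by (simp add: DERIV_imp_deriv [OF der])
  qed
  moreover have "z0 \<in> ball z0 d" using d by simp
  ultimately show "\<exists>W. z0 \<in> W \<and> W \<subseteq> U \<and> holo_on (\<lambda>z. deriv (\<lambda>l. f (z + l *s v)) 0) W"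
    using d by blast
qed

lemma holo_on_divide:
  assumes "holo_on f U" "holo_on g U" "\<And>z. z \<in> U \<Longrightarrow> g z \<noteq> 0"
  shows "holo_on (\<lambda>x. f x / g x) U"
  unfolding holo_on_def
proof (intro conjI ballI)
  show "open U" using assms by (simp add: holo_on_def)
  fix z assume z: "z \<in> U"
  then obtain L M where "(f has_derivative L) (at z)" "\<forall>c v. L (c *s v) = c * L v"
     "(g has_derivative M) (at z)" "\<forall>c v. M (c *s v) = c * M v"
    using assms(1,2) unfolding holo_on_def by blast
  then show "\<exists>L. ((\<lambda>x. f x / g x) has_derivative L) (at z) \<and> (\<forall>c v. L (c *s v) = c * L v)"
    using has_derivative_divide' [of f L z UNIV g M] assms(3) [OF z]
    by (intro exI [of _ "\<lambda>v. (L v * g z - f z * M v) / (g z * g z)"]) (simp add: algebra_simps)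
qed

section \<open>Changing one coordinate and dividing by a coordinate difference\<close>

definition vec_upd :: "'n \<Rightarrow> complex \<Rightarrow> complex^'n \<Rightarrow> complex^'n" where
  "vec_upd i w z = (\<chi> j. if j = i then w else z $ j)"

lemma vec_upd_nth [simp]: "vec_upd i w z $ j = (if j = i then w else z $ j)"
  by (simp add: vec_upd_def)

lemma vec_upd_triv [simp]: "vec_upd i (z $ i) z = z"
  by (simp add: vec_eq_iff)

lemma vec_upd_line: "vec_upd i (a + w) z = vec_upd i a z + w *s axis i 1"
  by (simp add: vec_eq_iff axis_def)

lemma holo_map_on_vec_upd:
  "holo_on g U \<Longrightarrow> holo_map_on (\<lambda>z. vec_upd i (g z) z) U"
  unfolding holo_map_on_def
proof
  fix j
  assume g: "holo_on g U"
  then show "holo_on (\<lambda>z. vec_upd i (g z) z $ j) U"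
    by (cases "j = i") (simp_all add: holo_on_coord holo_on_open [OF g])
qed

text \<open>In effect \<open>g z\<close> averages the partial derivative \<open>k\<close> over the
  segment from \<open>z\<close> to its projection onto the hyperplane where coordinate
  \<open>i\<close> equals \<open>z0 $ i\<close>. Averaging the linear part \<open>M\<close> of
  \<open>k\<close> over it gives the stated derivative, hence the factor 1/2.\<close>

lemma removable_quotient_differentiable:
  fixes h :: "complex^'n \<Rightarrow> complex"
  assumes h: "holo_on h U" and z0: "z0 \<in> U"
    and k: "(k has_derivative M) (at z0)" "\<And>c v. M (c *s v) = c * M v"
    and hk: "\<And>z. z \<in> U \<Longrightarrow> ((\<lambda>l. h (z + l *s axis i 1)) has_field_derivative k z) (at 0)"
  defines "g \<equiv> \<lambda>z. if z $ i = z0 $ i then k z else (h z - h (vec_upd i (z0 $ i) z)) / (z $ i - z0 $ i)"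
  shows "(g has_derivative (\<lambda>v. M v - M (axis i 1) * v $ i / 2)) (at z0)"
  unfolding has_derivative_at_alt
proof (intro conjI allI impI)
  have blM: "bounded_linear M" using k(1) by (rule has_derivative_bounded_linear)
  show "bounded_linear (\<lambda>v. M v - M (axis i 1) * v $ i / 2)"
    by (intro bounded_linear_sub blM bounded_linear_divide bounded_linear_compose [OF bounded_linear_divide]
        bounded_linear_compose [OF bounded_linear_mult_right bounded_linear_vec_nth])
  fix e :: real assume e: "e > 0"
  obtain d1 where d1: "d1 > 0" "\<And>y. norm (y - z0) < d1 \<Longrightarrow> norm (k y - k z0 - M (y - z0)) \<le> e / 3 * norm (y - z0)"
    using k(1) e unfolding has_derivative_at_alt by (metis divide_pos_pos zero_less_numeral)
  obtain d2 where d2: "d2 > 0" "ball z0 d2 \<subseteq> U"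
    using holo_on_open [OF h] z0 by (meson open_contains_ball)
  \<comment> \<open>The factor 3 pays for moving coordinate \<open>i\<close>: the vectors
    \<open>w \<xi>\<close> below have norm at most \<open>3 * norm v\<close>.\<close>
  define d where "d = min d1 d2 / 3"
  show "\<exists>d>0. \<forall>y. norm (y - z0) < d \<longrightarrow> norm (g y - g z0 - (M (y - z0) - M (axis i 1) * (y - z0) $ i / 2)) \<le> e * norm (y - z0)"
  proof (intro exI [of _ d] conjI allI impI)
    show "d > 0" using d1 d2 by (simp add: d_def)
    fix y :: "complex^'n" assume y: "norm (y - z0) < d"
    define v where "v = y - z0"
    have yv: "y = z0 + v" by (simp add: v_def)
    have gz0: "g z0 = k z0" by (simp add: g_def)
    show "norm (g y - g z0 - (M (y - z0) - M (axis i 1) * (y - z0) $ i / 2)) \<le> e * norm (y - z0)"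
    proof (cases "v $ i = 0")
      case True
      then have gy: "g y = k y" by (simp add: g_def yv)
      have "norm (k y - k z0 - M (y - z0)) \<le> e / 3 * norm (y - z0)"
        using d1(2) [of y] y d1 d2 by (simp add: d_def)
      also have "\<dots> \<le> e * norm (y - z0)"
        using e by (intro mult_right_mono) auto
      finally show ?thesis
        using True by (simp add: gy gz0 v_def)
    next
      case False
      \<comment> \<open>This is \<open>v\<close> with entry \<open>i\<close> replaced by
        \<open>\<xi>\<close>, running from the projection at 0 to \<open>v\<close> itself at
        \<open>v $ i\<close>.\<close>
      define w where "w \<xi> = v + (\<xi> - v $ i) *s axis i 1" for \<xi>
      define S where "S = cball (0::complex) (cmod (v $ i))"
      have vi: "cmod (v $ i) \<le> norm v" by (rule Finite_Cartesian_Product.norm_nth_le)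
      have nw: "norm (w \<xi>) \<le> 3 * norm v" if "\<xi> \<in> S" for \<xi>
      proof -
        have "norm (w \<xi>) \<le> norm v + cmod (\<xi> - v $ i)"
          unfolding w_def using norm_triangle_ineq [of v "(\<xi> - v $ i) *s axis i 1"]
          by (simp only: norm_vector_smult) simp
        moreover have "cmod (\<xi> - v $ i) \<le> cmod \<xi> + cmod (v $ i)" by (rule norm_triangle_ineq4)
        ultimately show ?thesis using that vi by (simp add: S_def)
      qed
      have nv: "3 * norm v < d1" "3 * norm v < d2" using y by (simp_all add: d_def v_def)
      have wU: "z0 + w \<xi> \<in> U" if "\<xi> \<in> S" for \<xi>
        using nw [OF that] nv d2 by (auto simp: dist_norm subset_iff)
      have w_eq: "w \<xi> = w 0 + \<xi> *s axis i 1" for \<xi>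
        by (simp add: w_def vec_eq_iff algebra_simps)
      have Mw: "M (w \<xi>) = M (w 0) + \<xi> * M (axis i 1)" for \<xi>
        unfolding w_eq [of \<xi>] by (simp add: bounded_linear.linear [OF blM] linear_add k(2))
      \<comment> \<open>\<open>h\<close> on the slice minus a primitive of the first-order expansion
        of \<open>k\<close>; the derivative is the remainder of \<open>k\<close>, to which the mean
        value inequality applies.\<close>
      define \<psi> where "\<psi> \<xi> = h (z0 + w \<xi>) - \<xi> * k z0 - (M (w 0) * \<xi> + M (axis i 1) * \<xi>\<^sup>2 / 2)" for \<xi>
      have d\<psi>: "(\<psi> has_field_derivative (k (z0 + w \<xi>) - k z0 - M (w \<xi>))) (at \<xi> within S)" if "\<xi> \<in> S" for \<xi>
      proof -
        have "((\<lambda>l. h (z0 + w \<xi> + l *s axis i 1)) has_field_derivative k (z0 + w \<xi>)) (at (\<xi> - \<xi>))"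
          using hk [OF wU [OF that]] by simp
        then have "((\<lambda>l. h (z0 + w \<xi> + (l - \<xi>) *s axis i 1)) has_field_derivative k (z0 + w \<xi>) * (1 - 0)) (at \<xi>)"
          by (rule DERIV_chain2) (intro derivative_intros)
        moreover have shift: "z0 + w \<xi> + (l - \<xi>) *s axis i 1 = z0 + w l" for l
          by (simp add: w_def vec_eq_iff algebra_simps)
        ultimately have "((\<lambda>l. h (z0 + w l)) has_field_derivative k (z0 + w \<xi>)) (at \<xi>)"
          unfolding shift by simp
        then have "(\<psi> has_field_derivative (k (z0 + w \<xi>) - k z0 - M (w \<xi>))) (at \<xi>)"
          unfolding \<psi>_def by (auto intro!: derivative_eq_intros simp: Mw [of \<xi>])
        then show ?thesis by (rule has_field_derivative_at_within)
      qed
      have bound: "cmod (k (z0 + w \<xi>) - k z0 - M (w \<xi>)) \<le> e * norm v" if "\<xi> \<in> S" for \<xi>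
      proof -
        have "cmod (k (z0 + w \<xi>) - k z0 - M (w \<xi>)) \<le> e / 3 * norm (w \<xi>)"
          using d1(2) [of "z0 + w \<xi>"] nw [OF that] nv by simp
        also have "\<dots> \<le> e / 3 * (3 * norm v)"
          using nw [OF that] e by (intro mult_left_mono) auto
        finally show ?thesis by simp
      qed
      have "cmod (\<psi> (v $ i) - \<psi> 0) \<le> e * norm v * cmod (v $ i - 0)"
        by (rule field_differentiable_bound [of S, OF _ d\<psi> bound]) (auto simp: S_def)
      moreover have "\<psi> (v $ i) - \<psi> 0 = v $ i * (g y - g z0 - (M v - M (axis i 1) * v $ i / 2))"
      proof -
        have "z0 + w (v $ i) = y" by (simp add: w_def yv)
        moreover have "z0 + w 0 = vec_upd i (z0 $ i) y"
          by (simp add: w_def yv vec_eq_iff axis_def)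
        moreover have "h y - h (vec_upd i (z0 $ i) y) = v $ i * g y"
          using False by (simp add: g_def yv)
        moreover have "M v = M (w 0) + v $ i * M (axis i 1)"
          using Mw [of "v $ i"] by (simp add: w_def)
        ultimately show ?thesis
          by (simp add: \<psi>_def gz0 algebra_simps power2_eq_square)
      qed
      ultimately have "cmod (v $ i) * cmod (g y - g z0 - (M v - M (axis i 1) * v $ i / 2)) \<le> cmod (v $ i) * (e * norm v)"
        by (simp add: norm_mult mult_ac)
      then show ?thesis
        using False by (simp add: v_def)
    qed
  qed
qed

section \<open>The polydisk\<close>

lemma vec_upd_polydisk: "z \<in> polydisk \<Longrightarrow> cmod w < 1 \<Longrightarrow> vec_upd i w z \<in> polydisk"
  by (simp add: polydisk_def)

lemma polydisk_nth: "z \<in> polydisk \<Longrightarrow> cmod (z $ i) < 1"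
  by (simp add: polydisk_def)

lemma holo_on_polydisk_slice:
  assumes "holo_on f polydisk" "z \<in> polydisk"
  shows "(\<lambda>w. f (vec_upd i w z)) holomorphic_on ball 0 1"
proof -
  have "(\<lambda>w. f (vec_upd i 0 z + w *s axis i 1)) holomorphic_on ball 0 1"
    by (rule holo_on_line [OF assms(1)])
      (use assms(2) in \<open>simp add: vec_upd_polydisk flip: vec_upd_line\<close>)
  then show ?thesis by (simp flip: vec_upd_line)
qed

text \<open>Holomorphy across \<open>z $ i = c\<close> comes from
  \<open>removable_quotient_differentiable\<close>. Away from that hyperplane the denominator bounds
  the quotient; near it the maximum principle in variable \<open>i\<close> does.\<close>

lemma polydisk_divide:
  fixes h :: "complex^'n \<Rightarrow> complex"
  assumes h: "bounded_holo_on h polydisk" and c: "cmod c < 1"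
  obtains g where "bounded_holo_on g polydisk"
    "\<And>z. z \<in> polydisk \<Longrightarrow> h z - h (vec_upd i c z) = (z $ i - c) * g z"
proof -
  obtain B where hol: "holo_on h polydisk" and B: "\<And>x. x \<in> polydisk \<Longrightarrow> cmod (h x) \<le> B"
    using h by (auto simp: bounded_holo_on_def)
  define k where "k z = deriv (\<lambda>l. h (z + l *s axis i 1)) 0" for z
  have k: "holo_on k polydisk"
    unfolding k_def by (rule holo_on_directional_deriv [OF hol B])
  define g where "g z = (if z $ i = c then k z else (h z - h (vec_upd i c z)) / (z $ i - c))" for z
  have opn: "open (polydisk :: (complex^'n) set)" using hol by (rule holo_on_open)
  have g_eq: "h z - h (vec_upd i c z) = (z $ i - c) * g z" for z
    by (cases "z $ i = c") (auto simp: g_def)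
  have upd: "holo_on (\<lambda>z. h (vec_upd i c z)) polydisk"
    by (rule holo_on_compose [OF hol holo_map_on_vec_upd [OF holo_on_const]])
      (use opn c vec_upd_polydisk in auto)
  have g: "holo_on g polydisk"
    unfolding holo_on_def
  proof (intro conjI ballI opn)
    fix z0 :: "complex^'n" assume z0: "z0 \<in> polydisk"
    show "\<exists>L. (g has_derivative L) (at z0) \<and> (\<forall>c v. L (c *s v) = c * L v)"
    proof (cases "z0 $ i = c")
      case True
      obtain M where M: "(k has_derivative M) (at z0)" "\<And>c v. M (c *s v) = c * M v"
        using k z0 unfolding holo_on_def by blast
      have hk: "((\<lambda>l. h (z + l *s axis i 1)) has_field_derivative k z) (at 0)" if z: "z \<in> polydisk" for z
      proof -
        obtain L where L: "(h has_derivative L) (at z)" "\<And>c v. L (c *s v) = c * L v"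
          using hol z unfolding holo_on_def by blast
        have d: "((\<lambda>l. h (z + l *s axis i 1)) has_field_derivative L (axis i 1)) (at 0)"
          by (rule holo_on_line_deriv) (use L in auto)
        have "k z = L (axis i 1)"
          unfolding k_def by (rule DERIV_imp_deriv [OF d])
        with d show ?thesis by simp
      qed
      have gd: "(g has_derivative (\<lambda>v. M v - M (axis i 1) * v $ i / 2)) (at z0)"
        using removable_quotient_differentiable [OF hol z0 M hk] unfolding True g_def [abs_def] by blast
      have "M (c *s v) - M (axis i 1) * (c *s v) $ i / 2 = c * (M v - M (axis i 1) * v $ i / 2)" for c v
        unfolding M(2) by (simp add: algebra_simps)
      then show ?thesis
        by (intro exI [of _ "\<lambda>v. M v - M (axis i 1) * v $ i / 2"] conjI gd) blast
    next
      case False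
      define W where "W = polydisk \<inter> {z. z $ i \<noteq> c}"
      have oW: "open W"
        unfolding W_def
        by (intro open_Int opn open_Collect_neq linear_continuous_on [OF bounded_linear_vec_nth] continuous_on_const)
      have sub: "W \<subseteq> polydisk" by (auto simp: W_def)
      have "holo_on (\<lambda>z. (h z - h (vec_upd i c z)) / (z $ i - c)) W"
        by (rule holo_on_divide [OF holo_on_diff [OF holo_on_subset [OF hol sub oW] holo_on_subset [OF upd sub oW]]
              holo_on_diff [OF holo_on_coord [OF oW] holo_on_const [OF oW]]]) (simp add: W_def)
      then have "holo_on g W"
        by (rule holo_on_cong_open [OF _ oW order_refl]) (simp add: W_def g_def)
      moreover have "z0 \<in> W" using z0 False by (simp add: W_def)
      ultimately show ?thesis unfolding holo_on_def [of g] by blast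
    qed
  qed
  define e where "e = (1 - cmod c) / 2"
  have e: "e > 0" using c by (simp add: e_def)
  have far: "cmod (g z) \<le> 2 * B / e" if z: "z \<in> polydisk" and zc: "cmod (z $ i - c) \<ge> e" for z
  proof -
    have "cmod (z $ i - c) * cmod (g z) = cmod (h z - h (vec_upd i c z))"
      by (simp add: g_eq norm_mult)
    also have "\<dots> \<le> cmod (h z) + cmod (h (vec_upd i c z))" by (rule norm_triangle_ineq4)
    also have "\<dots> \<le> B + B" using B z c vec_upd_polydisk by (intro add_mono) auto
    finally have "cmod (z $ i - c) * cmod (g z) \<le> 2 * B" by simp
    moreover have "e * cmod (g z) \<le> cmod (z $ i - c) * cmod (g z)"
      using zc by (intro mult_right_mono) auto
    ultimately show ?thesis using e by (simp add: pos_le_divide_eq mult.commute)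
  qed
  \<comment> \<open>Since \<open>\<rho> - cmod c = e\<close>, the circle of radius
    \<open>\<rho>\<close> keeps distance at least \<open>e\<close> from \<open>c\<close>.\<close>
  define \<rho> where "\<rho> = (1 + cmod c) / 2"
  have \<rho>: "0 < \<rho>" "\<rho> < 1"
    using c by (simp_all add: \<rho>_def add_pos_nonneg)
  have big: "cmod (w - c) \<ge> e" if "cmod w \<ge> \<rho>" for w
    using norm_triangle_ineq2 [of w c] that by (simp add: e_def \<rho>_def field_simps)
  have bd: "cmod (g z) \<le> 2 * B / e" if z: "z \<in> polydisk" for z
  proof (cases "cmod (z $ i) \<ge> \<rho>")
    case True
    then show ?thesis using far z big by blast
  next
    case False
    define f where "f w = g (vec_upd i w z)" for w
    have hf: "f holomorphic_on ball 0 1"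
      unfolding f_def by (rule holo_on_polydisk_slice [OF g z])
    have sub: "cball 0 \<rho> \<subseteq> ball (0::complex) 1" using \<rho> by auto
    have "cmod (f (z $ i)) \<le> 2 * B / e"
    proof (rule maximum_modulus_frontier [of f "cball 0 \<rho>"])
      show "f holomorphic_on interior (cball 0 \<rho>)"
        using hf sub interior_subset by (meson holomorphic_on_subset order_trans)
      show "continuous_on (closure (cball 0 \<rho>)) f"
        using holomorphic_on_imp_continuous_on [OF hf] sub by (simp add: continuous_on_subset)
      show "cmod (f w) \<le> 2 * B / e" if "w \<in> frontier (cball 0 \<rho>)" for w
      proof -
        have w: "cmod w = \<rho>" using that \<rho> by (simp add: frontier_cball)
        show ?thesis
          unfolding f_def by (rule far) (use w z \<rho> big [of w] vec_upd_polydisk in auto)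
      qed
    qed (use False in auto)
    then show ?thesis by (simp add: f_def)
  qed
  show thesis
  proof (rule that)
    show "bounded_holo_on g polydisk"
      unfolding bounded_holo_on_def using g bd by blast
  qed (rule g_eq)
qed

lemma polydisk_smult:
  assumes "z \<in> polydisk" "cmod l \<le> 1"
  shows "l *s z \<in> polydisk"
proof -
  have "cmod l * cmod (z $ i) < 1" for i
    using mult_left_le_one_le [of "cmod (z $ i)" "cmod l"] polydisk_nth [OF assms(1), of i] assms(2) by simp
  then show ?thesis by (simp add: polydisk_def norm_mult)
qed

text \<open>As \<open>\<bar>w\<bar> \<rightarrow> 1\<close> the Schwarz-Pick lemma in the variable \<open>\<eta>\<close> forces
  \<open>g (vec_upd i w (\<eta> *s x)) - w\<close> to vanish on the boundary of the disk of \<open>w\<close>'s.\<close>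
lemma polydisk_identity_slice_step:
  fixes g :: "complex^'n \<Rightarrow> complex"
  assumes g: "holo_on g polydisk" and less: "\<And>z. z \<in> polydisk \<Longrightarrow> cmod (g z) < 1"
    and x: "x \<in> polydisk" and a: "cmod a < 1" and b: "cmod b < 1"
    and ida: "\<And>w. cmod w < 1 \<Longrightarrow> g (vec_upd i w (a *s x)) = w" and w: "cmod w < 1"
  shows "g (vec_upd i w (b *s x)) = w"
proof -
  \<comment> \<open>\<open>d / c\<close> is the pseudohyperbolic distance of \<open>a\<close> and
    \<open>b\<close>; being less than 1, it makes \<open>c - d\<close> positive.\<close>
  define c d where "c = cmod (1 - cnj a * b)" and "d = cmod (b - a)"
  have "cmod (Moebius_function 0 a b) < 1"
    using a b by (rule Moebius_function_norm_lt_1)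
  then have "d / c < 1"
    by (simp add: Moebius_function_simple norm_divide c_def d_def)
  moreover have c0: "c > 0"
  proof -
    have "cmod (cnj a * b) < 1"
      using mult_strict_mono' [of "cmod a" 1 "cmod b" 1] a b by (simp add: norm_mult)
    then have "cnj a * b \<noteq> 1" by auto
    then show ?thesis by (simp add: c_def)
  qed
  ultimately have dc: "d < c" by (simp add: pos_divide_less_eq)
  have d0: "d \<ge> 0" by (simp add: d_def)
  have bound: "cmod (g (vec_upd i w (b *s x)) - w) \<le> (2 * d / (c - d)) * sqrt (1 - cmod w)" if w: "cmod w < 1" for w
  proof -
    define u where "u \<eta> = g (vec_upd i w (\<eta> *s x))" for \<eta>
    have line: "vec_upd i w (\<eta> *s x) = vec_upd i w 0 + \<eta> *s vec_upd i 0 x" for \<eta>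
      by (simp add: vec_eq_iff)
    have mem: "vec_upd i w (\<eta> *s x) \<in> polydisk" if "cmod \<eta> < 1" for \<eta>
      using that w x by (intro vec_upd_polydisk polydisk_smult) auto
    have hol: "u holomorphic_on ball 0 1"
      unfolding u_def line by (rule holo_on_line [OF g]) (use mem line in auto)
    have ul: "cmod (u \<eta>) < 1" if "cmod \<eta> < 1" for \<eta>
      unfolding u_def using less mem that by blast
    define D where "D = cmod (u b - w)"
    have ua: "u a = w" using ida w by (simp add: u_def)
    have "D * c \<le> d * cmod (1 - cnj w * u b)"
      using Schwarz_Pick [OF hol ul b a] by (simp add: ua D_def c_def d_def)
    also have "\<dots> \<le> d * ((1 - (cmod w)\<^sup>2) + D)"
    proof (intro mult_left_mono d0)
      \<comment> \<open>Expanding around \<open>w\<close> exposes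
        \<open>1 - (cmod w)\<^sup>2\<close>, which vanishes as \<open>cmod w\<close> tends to 1; the
        term in \<open>D\<close> is absorbed on the left because \<open>d < c\<close>.\<close>
      have "1 - cnj w * u b = of_real (1 - (cmod w)\<^sup>2) - cnj w * (u b - w)"
        unfolding of_real_diff complex_norm_square by (simp add: algebra_simps)
      then have "cmod (1 - cnj w * u b) \<le> cmod (of_real (1 - (cmod w)\<^sup>2)) + cmod (cnj w * (u b - w))"
        by (metis norm_triangle_ineq4)
      also have "cmod (of_real (1 - (cmod w)\<^sup>2)) = 1 - (cmod w)\<^sup>2"
        using w by (subst norm_of_real) (simp add: power_le_one)
      also have "cmod (cnj w * (u b - w)) \<le> D"
        using w by (simp add: norm_mult D_def mult_left_le_one_le)
      finally show "cmod (1 - cnj w * u b) \<le> (1 - (cmod w)\<^sup>2) + D" by simp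
    qed
    finally have 1: "D * (c - d) \<le> d * (1 - (cmod w)\<^sup>2)"
      by (simp add: algebra_simps)
    \<comment> \<open>The linear decay is weakened to a square root to fit
      \<open>boundary_zero_imp_zero\<close>.\<close>
    have "1 - (cmod w)\<^sup>2 \<le> 2 * sqrt (1 - cmod w)"
    proof -
      have "1 - (cmod w)\<^sup>2 = (1 + cmod w) * (1 - cmod w)"
        by (simp add: power2_eq_square algebra_simps)
      also have "\<dots> \<le> 2 * (1 - cmod w)"
        using w by (intro mult_right_mono) auto
      also have "1 - cmod w \<le> sqrt (1 - cmod w)"
        using w by (intro real_le_rsqrt) (simp add: power2_eq_square mult_left_le_one_le)
      finally show ?thesis by simp
    qed
    then have "d * (1 - (cmod w)\<^sup>2) \<le> d * (2 * sqrt (1 - cmod w))"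
      by (rule mult_left_mono [OF _ d0])
    with 1 have "D * (c - d) \<le> d * (2 * sqrt (1 - cmod w))" by linarith
    then show ?thesis
      using dc by (simp add: D_def u_def pos_le_divide_eq mult_ac)
  qed
  have bx: "b *s x \<in> polydisk" using x b by (intro polydisk_smult) auto
  have "g (vec_upd i w (b *s x)) - w = 0"
    by (rule boundary_zero_imp_zero [of "\<lambda>w. g (vec_upd i w (b *s x)) - w", OF _ bound w])
      (intro holomorphic_intros holo_on_polydisk_slice [OF g bx])
  then show ?thesis by simp
qed

text \<open>By the parallelogram law the midpoint of 1 and \<open>u\<close> has modulus at most
  \<open>1 - x\<^sup>2 / 8\<close> with \<open>x = cmod (1 - u)\<close>. This gain absorbs the
  perturbation, of size at most \<open>e * x\<close>, up to \<open>2 * e\<^sup>2\<close>.\<close>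

lemma norm_midpoint_perturbed_le:
  fixes u v :: complex
  assumes u: "cmod u \<le> 1" and v: "cmod v \<le> 1" and e: "e \<ge> 0"
  shows "cmod ((1 + u) / 2 + e * ((1 - u) * v)) \<le> 1 + 2 * e\<^sup>2"
proof -
  define x where "x = cmod (1 - u)"
  have x: "0 \<le> x" "x \<le> 2"
    using norm_triangle_ineq4 [of 1 u] u by (simp_all add: x_def)
  have "(cmod (1 + u))\<^sup>2 + x\<^sup>2 = 2 + 2 * (cmod u)\<^sup>2"
    unfolding x_def cmod_power2 by (simp add: power2_eq_square algebra_simps)
  moreover have "(cmod u)\<^sup>2 \<le> 1" using u by (simp add: power_le_one)
  ultimately have "(cmod (1 + u))\<^sup>2 \<le> 4 - x\<^sup>2" by linarith
  also have "\<dots> \<le> 4 - x\<^sup>2 + (x\<^sup>2 / 4)\<^sup>2" by simp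
  also have "\<dots> = (2 - x\<^sup>2 / 4)\<^sup>2"
    by (simp add: power2_eq_square algebra_simps)
  finally have "cmod (1 + u) \<le> 2 - x\<^sup>2 / 4"
  proof (rule power2_le_imp_le)
    have "x\<^sup>2 \<le> 2\<^sup>2" using x by (intro power_mono) auto
    then show "0 \<le> 2 - x\<^sup>2 / 4" by simp
  qed
  then have 1: "cmod ((1 + u) / 2) \<le> 1 - x\<^sup>2 / 8"
    by (simp add: norm_divide)
  have 2: "cmod (e * ((1 - u) * v)) \<le> e * x"
    using e v by (simp add: norm_mult x_def mult_left_mono mult_left_le)
  have "0 \<le> (x / 4 - e)\<^sup>2" by simp
  then have 3: "e * x - x\<^sup>2 / 8 \<le> 2 * e\<^sup>2"
    by (simp add: power2_eq_square algebra_simps)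
  have "cmod ((1 + u) / 2 + e * ((1 - u) * v)) \<le> cmod ((1 + u) / 2) + cmod (e * ((1 - u) * v))"
    by (rule norm_triangle_ineq)
  with 1 2 3 show ?thesis by linarith
qed

lemma rotate_to_norm: obtains c where "cmod c = 1" "c * a = complex_of_real (cmod a)"
proof (cases "a = 0")
  case True
  then show thesis by (intro that [of 1]) auto
next
  case False
  show thesis
    using False
    by (intro that [of "cnj a / cmod a"])
      (simp_all add: norm_divide complex_norm_square [symmetric] mult.commute power2_eq_square)
qed

section \<open>Approximate multiplicativity of the extension operator\<close>

context isometric_extension
begin

text \<open>The functional \<open>f \<mapsto> extension f z\<close> is a state; where it takes a contraction \<open>u\<close> to a value of modulus
  nearly 1, it is nearly multiplicative against \<open>u\<close>.\<close>
lemma extension_nearly_multiplicative_real: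
  assumes u: "bounded_holo_on u \<Omega>" "\<And>x. x \<in> V \<Longrightarrow> cmod (u x) \<le> 1"
    and g: "bounded_holo_on g \<Omega>" "\<And>x. x \<in> V \<Longrightarrow> cmod (g x) \<le> 1"
    and z: "z \<in> \<Omega>" and t: "extension u z = complex_of_real t" "0 \<le> t"
  shows "cmod (extension (\<lambda>x. u x * g x) z - t * extension g z) \<le> 3 * sqrt (1 - t)"
proof -
  have t1: "t \<le> 1"
    using extension_le [OF u z] t by simp
  define d where "d = extension g z - extension (\<lambda>x. u x * g x) z"
  have ug: "bounded_holo_on (\<lambda>x. u x * g x) \<Omega>"
    by (rule bounded_holo_on_mult [OF u(1) g(1)])
  obtain c where c: "cmod c = 1" "c * d = of_real (cmod d)"
    by (rule rotate_to_norm)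
  have est: "e * cmod d \<le> (1 - t) / 2 + 2 * e\<^sup>2" if e: "e \<ge> 0" for e
  proof -
    \<comment> \<open>A test function bounded by \<open>1 + 2 * e\<^sup>2\<close> on
      \<open>V\<close>. The phase \<open>c\<close> makes its extension at \<open>z\<close> equal to
      \<open>(1 + t) / 2 + e * cmod d\<close>, and comparing the two bounds
      \<open>d\<close>.\<close>
    define F where "F x = (1 + u x) / 2 + e * ((1 - u x) * (c * g x))" for x
    have F_eq: "F = (\<lambda>x. (1/2) * (1 + u x) + (of_real e * c) * (g x - u x * g x))"
      by (auto simp: F_def algebra_simps)
    note b1 = bounded_holo_on_add [OF bounded_holo_on_const [OF open_dom, of 1] u(1)]
    note b2 = bounded_holo_on_diff [OF g(1) ug]
    have bF: "bounded_holo_on F \<Omega>"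
      unfolding F_eq by (intro bounded_holo_on_add [OF bounded_holo_on_cmult bounded_holo_on_cmult] b1 b2)
    have "extension F z = (1/2) * (1 + t) + (of_real e * c) * d"
      unfolding F_eq
      by (simp only: extension_add [OF bounded_holo_on_cmult [OF b1] bounded_holo_on_cmult [OF b2]] extension_cmult [OF b1] extension_cmult [OF b2]
          extension_add [OF bounded_holo_on_const [OF open_dom] u(1)] extension_diff [OF g(1) ug] extension_one [OF z] t d_def)
        simp
    also have "\<dots> = of_real ((1 + t) / 2 + e * cmod d)"
      using c(2) by (simp add: mult.assoc)
    finally have AF: "extension F z = of_real ((1 + t) / 2 + e * cmod d)" .
    have "cmod (extension F z) \<le> 1 + 2 * e\<^sup>2"
    proof (rule extension_le [OF bF _ z])
      fix x assume x: "x \<in> V"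
      show "cmod (F x) \<le> 1 + 2 * e\<^sup>2"
        unfolding F_def by (rule norm_midpoint_perturbed_le) (use u(2) [OF x] g(2) [OF x] c(1) e in \<open>simp_all add: norm_mult\<close>)
    qed
    moreover have "cmod (extension F z) = (1 + t) / 2 + e * cmod d"
      unfolding AF using t e by (subst norm_of_real) simp
    ultimately show ?thesis by (simp add: field_simps)
  qed
  \<comment> \<open>The optimal \<open>e\<close> is \<open>sqrt (1 - t) / 2\<close>; for
    \<open>t = 1\<close> this is 0, and arbitrarily small positive \<open>e\<close> are used
    instead.\<close>
  have d: "cmod d \<le> 2 * sqrt (1 - t)"
  proof (cases "t = 1")
    case True
    have "cmod d \<le> 0 + e" if e: "e > 0" for e
    proof -
      have "e / 2 * cmod d \<le> e / 2 * e"
        using est [of "e / 2"] e True by (simp add: power2_eq_square)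
      then show ?thesis using e by simp
    qed
    then have "cmod d \<le> 0" by (rule field_le_epsilon)
    then show ?thesis using True by simp
  next
    case False
    define e where "e = sqrt (1 - t) / 2"
    have e: "e > 0" using False t1 by (simp add: e_def)
    have e2: "1 - t = 4 * e\<^sup>2"
      using t1 by (simp add: e_def power_divide)
    have "e * cmod d \<le> e * (4 * e)"
      using est [of e] e by (simp add: e2 power2_eq_square)
    then have "cmod d \<le> 4 * e"
      using e by simp
    then show ?thesis by (simp add: e_def)
  qed
  have "extension (\<lambda>x. u x * g x) z - t * extension g z = of_real (1 - t) * extension g z - d"
    by (simp add: d_def algebra_simps)
  then have "cmod (extension (\<lambda>x. u x * g x) z - t * extension g z) \<le> cmod (of_real (1 - t) * extension g z) + cmod d"
    by (simp only: norm_triangle_ineq4)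
  also have "cmod (of_real (1 - t) * extension g z) \<le> (1 - t) * 1"
    unfolding norm_mult norm_of_real
  proof (rule mult_mono)
    show "cmod (extension g z) \<le> 1" using g z by (rule extension_le)
  qed (use t1 in simp_all)
  also have "(1 - t) * 1 \<le> sqrt (1 - t)"
  proof -
    have "(1 - t)\<^sup>2 \<le> 1 - t"
      using t t1 mult_left_le_one_le [of "1 - t" "1 - t"] by (simp add: power2_eq_square)
    then show ?thesis by (simp add: real_le_rsqrt)
  qed
  finally show ?thesis using d by linarith
qed

text \<open>A unimodular factor on \<open>u\<close> makes its extension at \<open>z\<close>
  nonnegative, which is the previous case.\<close>

lemma extension_nearly_multiplicative:
  assumes u: "bounded_holo_on u \<Omega>" "\<And>x. x \<in> V \<Longrightarrow> cmod (u x) \<le> 1"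
    and g: "bounded_holo_on g \<Omega>" "\<And>x. x \<in> V \<Longrightarrow> cmod (g x) \<le> 1"
    and z: "z \<in> \<Omega>"
  shows "cmod (extension (\<lambda>x. u x * g x) z - extension u z * extension g z) \<le> 3 * sqrt (1 - cmod (extension u z))"
proof -
  obtain c where c: "cmod c = 1" "c * extension u z = of_real (cmod (extension u z))"
    by (rule rotate_to_norm)
  note cu = bounded_holo_on_cmult [OF u(1), of c]
  note ug = bounded_holo_on_mult [OF u(1) g(1)]
  have "cmod (extension (\<lambda>x. (c * u x) * g x) z - of_real (cmod (extension u z)) * extension g z) \<le> 3 * sqrt (1 - cmod (extension u z))"
    by (rule extension_nearly_multiplicative_real [OF cu _ g z])
      (use c u(2) in \<open>simp_all add: norm_mult extension_cmult [OF u(1)]\<close>)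
  moreover have "extension (\<lambda>x. (c * u x) * g x) z - of_real (cmod (extension u z)) * extension g z = c * (extension (\<lambda>x. u x * g x) z - extension u z * extension g z)"
    using extension_cmult [OF ug, of c z] by (simp add: c(2) [symmetric] mult.assoc algebra_simps)
  ultimately show ?thesis using c(1) by (simp add: norm_mult)
qed

end

section \<open>Elimination of coordinates in the polydisk\<close>

locale polydisk_extension = isometric_extension +
  assumes Omega_eq: "\<Omega> = polydisk"
begin

text \<open>The identity travels from \<open>z0\<close> to the centre along the disk through
  \<open>x\<close>, then from the centre out to \<open>z\<close> along the disk through
  \<open>y\<close>.\<close>

lemma identity_slice_imp_coord:
  assumes g: "holo_on g \<Omega>" and less: "\<And>z. z \<in> \<Omega> \<Longrightarrow> cmod (g z) < 1"
    and z0: "z0 \<in> \<Omega>" and id0: "\<And>w. cmod w < 1 \<Longrightarrow> g (vec_upd i w z0) = w" and z: "z \<in> \<Omega>"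
  shows "g z = z $ i"
proof -
  note step = polydisk_identity_slice_step [of g, folded Omega_eq, OF g less]
  obtain s x where s: "0 < s" "s < 1" "x \<in> \<Omega>" "z0 = s *\<^sub>R x"
    using shrink_mem [OF z0] .
  obtain t y where t: "0 < t" "t < 1" "y \<in> \<Omega>" "z = t *\<^sub>R y"
    using shrink_mem [OF z] .
  have at_0: "g (vec_upd i w 0) = w" if "cmod w < 1" for w
  proof -
    have "g (vec_upd i w (0 *s x)) = w"
      by (rule step [of x "of_real s"]) (use s that id0 in \<open>simp_all add: of_real_vector_smult\<close>)
    then show ?thesis by simp
  qed
  have "g (vec_upd i (z $ i) (of_real t *s y)) = z $ i"
    by (rule step [of y 0])
      (use t at_0 z polydisk_nth [of z i] in \<open>simp_all add: Omega_eq\<close>)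
  then show ?thesis
    by (simp add: of_real_vector_smult flip: t(4))
qed

text \<open>A minimal \<open>I\<close> consists of coordinates over which the retract is a graph.\<close>
definition factor_map :: "'a set \<Rightarrow> (complex^'a \<Rightarrow> complex^'a) \<Rightarrow> bool" where
  "factor_map I \<psi> \<longleftrightarrow> holo_map_on \<psi> \<Omega> \<and> \<psi> ` \<Omega> \<subseteq> \<Omega> \<and> (\<forall>x\<in>V. \<psi> x = x) \<and>
     (\<forall>z\<in>\<Omega>. \<forall>z'\<in>\<Omega>. (\<forall>j\<in>I. z $ j = z' $ j) \<longrightarrow> \<psi> z = \<psi> z')"

text \<open>On a slice in direction \<open>i\<close>, coordinate \<open>i\<close> of
  \<open>\<psi>\<close> is a self-map of the disk with at most one fixed point: two would make it
  the identity there, hence \<open>\<psi> z $ i = z $ i\<close> everywhere, against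
  \<open>z1\<close>. Solving the fixed point equation holomorphically eliminates coordinate
  \<open>i\<close>.\<close>

lemma factor_map_drop_coord:
  assumes \<psi>: "factor_map I \<psi>" and i: "i \<in> I" and z1: "z1 \<in> \<Omega>" "\<psi> z1 $ i \<noteq> z1 $ i"
  shows "\<exists>\<psi>'. factor_map (I - {i}) \<psi>'"
proof -
  have hol: "holo_map_on \<psi> \<Omega>" and dom: "\<psi> ` \<Omega> \<subseteq> \<Omega>" and fixV: "\<And>x. x \<in> V \<Longrightarrow> \<psi> x = x"
    and dep: "\<And>z z'. z \<in> \<Omega> \<Longrightarrow> z' \<in> \<Omega> \<Longrightarrow> \<forall>j\<in>I. z $ j = z' $ j \<Longrightarrow> \<psi> z = \<psi> z'"
    using \<psi> unfolding factor_map_def by blast+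
  have hi: "holo_on (\<lambda>z. \<psi> z $ i) \<Omega>"
    using hol by (simp add: holo_map_on_def)
  have less: "cmod (\<psi> z $ i) < 1" if "z \<in> \<Omega>" for z
    using dom that polydisk_nth [of "\<psi> z" i] by (auto simp: Omega_eq)
  have upd: "vec_upd i w z \<in> \<Omega>" if "z \<in> \<Omega>" "cmod w < 1" for w z
    using that vec_upd_polydisk by (simp add: Omega_eq)
  have unique: "a = b" if z: "z \<in> \<Omega>" and a: "cmod a < 1" "\<psi> (vec_upd i a z) $ i = a"
    and b: "cmod b < 1" "\<psi> (vec_upd i b z) $ i = b" for z a b
  proof (rule ccontr)
    assume ne: "a \<noteq> b"
    have hs: "(\<lambda>w. \<psi> (vec_upd i w z) $ i) holomorphic_on ball 0 1"
      using holo_on_polydisk_slice [of "\<lambda>z. \<psi> z $ i" z i] hi z by (simp add: Omega_eq)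
    have id: "\<psi> (vec_upd i w z) $ i = w" if "cmod w < 1" for w
      by (rule two_fixed_points_imp_id [OF hs _ a b ne that]) (use less upd z in blast)
    have "\<psi> z1 $ i = z1 $ i"
      by (rule identity_slice_imp_coord [OF hi _ z _ z1(1)]) (use less id in blast)+
    with z1(2) show False by simp
  qed
  \<comment> \<open>\<open>R\<close> changes coordinate \<open>i\<close> only, so the retraction
    \<open>\<rho>\<close> moves each point within its slice to a solution of
    \<open>\<psi> z $ i = z $ i\<close>.\<close>
  define R where "R z = vec_upd i (\<psi> z $ i) z" for z
  have R: "holo_map_on R \<Omega>" unfolding R_def by (rule holo_map_on_vec_upd [OF hi])
  have R_dom: "R ` \<Omega> \<subseteq> \<Omega>" unfolding R_def using upd less by blast
  obtain v where v: "v \<in> V" using V_ne by blast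
  have R_V: "R x = x" if "x \<in> V" for x using fixV [OF that] by (simp add: R_def)
  have "v \<in> \<Omega>" using v V_sub by blast
  obtain \<rho> where \<rho>: "holo_map_on \<rho> \<Omega>" "\<rho> ` \<Omega> \<subseteq> \<Omega>" "\<And>z. z \<in> \<Omega> \<Longrightarrow> R (\<rho> z) = \<rho> z"
    "\<And>z. z \<in> \<Omega> \<Longrightarrow> R z = z \<Longrightarrow> \<rho> z = z"
    "\<And>j z. \<forall>w\<in>\<Omega>. R w $ j = w $ j \<Longrightarrow> z \<in> \<Omega> \<Longrightarrow> \<rho> z $ j = z $ j"
    by (rule retraction_onto_fixed_points [OF R R_dom \<open>v \<in> \<Omega>\<close> R_V [OF v]], rule that) blast+
  have \<rho>_coord: "\<rho> z $ j = z $ j" if "z \<in> \<Omega>" "j \<noteq> i" for z j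
    by (rule \<rho>(5)) (use that in \<open>simp_all add: R_def\<close>)
  have \<rho>_mem: "\<rho> z \<in> \<Omega>" if "z \<in> \<Omega>" for z using \<rho>(2) that by blast
  have \<psi>\<rho>: "\<psi> (\<rho> z) $ i = \<rho> z $ i" if "z \<in> \<Omega>" for z
    using arg_cong [OF \<rho>(3) [OF that], of "\<lambda>x. x $ i"] by (simp add: R_def)
  have "factor_map (I - {i}) (\<lambda>z. \<psi> (\<rho> z))"
    unfolding factor_map_def
  proof (intro conjI ballI impI)
    show "holo_map_on (\<lambda>z. \<psi> (\<rho> z)) \<Omega>" by (rule holo_map_on_compose [OF hol \<rho>(1,2)])
    show "(\<lambda>z. \<psi> (\<rho> z)) ` \<Omega> \<subseteq> \<Omega>" using dom \<rho>_mem by blast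
    show "\<psi> (\<rho> x) = x" if "x \<in> V" for x
      using \<rho>(4) [of x] R_V [OF that] fixV [OF that] V_sub that by auto
    fix z z' assume z: "z \<in> \<Omega>" and z': "z' \<in> \<Omega>" and agree: "\<forall>j\<in>I - {i}. z $ j = z' $ j"
    \<comment> \<open>The two arguments of \<open>\<psi>\<close> agree on \<open>I\<close>: at
      \<open>i\<close> by construction, elsewhere because \<open>\<rho>\<close> leaves those
      coordinates alone.\<close>
    have slice: "\<psi> (vec_upd i (\<rho> y $ i) z) = \<psi> (\<rho> y)" if y: "y \<in> \<Omega>" "\<forall>j\<in>I - {i}. z $ j = y $ j" for y
      using y \<rho>_mem [OF y(1)] polydisk_nth [of "\<rho> y" i] z \<rho>_coord [OF y(1)]
      by (intro dep upd) (auto simp: Omega_eq)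
    have "\<rho> z $ i = \<rho> z' $ i"
    proof (rule unique [OF z])
      show "\<psi> (vec_upd i (\<rho> z $ i) z) $ i = \<rho> z $ i" using slice [OF z] \<psi>\<rho> [OF z] by simp
      show "\<psi> (vec_upd i (\<rho> z' $ i) z) $ i = \<rho> z' $ i" using slice [OF z' agree] \<psi>\<rho> [OF z'] by simp
    qed (use \<rho>_mem [OF z] \<rho>_mem [OF z'] polydisk_nth in \<open>auto simp: Omega_eq\<close>)
    then show "\<psi> (\<rho> z) = \<psi> (\<rho> z')"
      using agree \<rho>_coord [OF z] \<rho>_coord [OF z'] by (intro dep \<rho>_mem z z') (metis Diff_iff singletonD)
  qed
  then show ?thesis by blast
qed

text \<open>The state at \<open>\<psi> z\<close> sends coordinate \<open>i\<close> to
  \<open>z $ i\<close>, so the defect \<open>H\<close> is bounded by a multiple of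
  \<open>sqrt (1 - cmod (z $ i))\<close>. It tends to 0 as \<open>z $ i\<close> approaches the unit
  circle, hence vanishes on each slice.\<close>

lemma extension_coord_multiplicative:
  assumes \<psi>: "holo_map_on \<psi> \<Omega>" "\<psi> ` \<Omega> \<subseteq> \<Omega>"
    and coord: "\<And>z. z \<in> \<Omega> \<Longrightarrow> extension (\<lambda>x. x $ i) (\<psi> z) = z $ i"
    and g: "bounded_holo_on g \<Omega>" and z: "z \<in> \<Omega>"
  shows "extension (\<lambda>x. x $ i * g x) (\<psi> z) = z $ i * extension g (\<psi> z)"
proof -
  note ci = bh_poly [OF poly_fun.coord [of i]]
  note ig = bounded_holo_on_mult [OF ci g]
  obtain B0 where B0: "\<And>x. x \<in> \<Omega> \<Longrightarrow> cmod (g x) \<le> B0"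
    using g by (auto simp: bounded_holo_on_def)
  \<comment> \<open>A positive bound, so that \<open>g\<close> can be divided by it and become a
    contraction.\<close>
  define B where "B = \<bar>B0\<bar> + 1"
  have B: "B > 0" "\<And>x. x \<in> \<Omega> \<Longrightarrow> cmod (g x) \<le> B"
  proof -
    show "B > 0" by (simp add: B_def)
    show "cmod (g x) \<le> B" if "x \<in> \<Omega>" for x
      using B0 [OF that] by (simp add: B_def)
  qed
  define H where "H z = extension (\<lambda>x. x $ i * g x) (\<psi> z) - z $ i * extension g (\<psi> z)" for z
  have "holo_on H \<Omega>"
    unfolding H_def
    by (intro holo_on_diff holo_on_mult holo_on_coord open_dom
        holo_on_compose [OF extension_holo [OF ig] \<psi>] holo_on_compose [OF extension_holo [OF g] \<psi>])
  then have slice: "(\<lambda>w. H (vec_upd i w z)) holomorphic_on ball 0 1"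
    using holo_on_polydisk_slice z by (simp add: Omega_eq)
  have H_le: "cmod (H y) \<le> 3 * B * sqrt (1 - cmod (y $ i))" if y: "y \<in> \<Omega>" for y
  proof -
    have py: "\<psi> y \<in> \<Omega>" using \<psi>(2) y by blast
    define g' where "g' x = (1 / of_real B) * g x" for x
    have g': "bounded_holo_on g' \<Omega>" unfolding g'_def by (rule bounded_holo_on_cmult [OF g])
    have "cmod (extension (\<lambda>x. x $ i * g' x) (\<psi> y) - extension (\<lambda>x. x $ i) (\<psi> y) * extension g' (\<psi> y)) \<le> 3 * sqrt (1 - cmod (extension (\<lambda>x. x $ i) (\<psi> y)))"
    proof (rule extension_nearly_multiplicative [OF ci _ g' _ py])
      fix x assume "x \<in> V"
      then have x: "x \<in> \<Omega>" using V_sub by blast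
      show "cmod (x $ i) \<le> 1" using polydisk_nth [of x i] x by (simp add: Omega_eq)
      show "cmod (g' x) \<le> 1" using B(1) B(2) [OF x] by (simp add: g'_def norm_divide norm_mult)
    qed
    moreover have "extension (\<lambda>x. x $ i * g' x) (\<psi> y) = (1 / of_real B) * extension (\<lambda>x. x $ i * g x) (\<psi> y)"
      using extension_cmult [OF ig, of "1 / of_real B" "\<psi> y"] by (simp add: g'_def mult_ac)
    moreover have "extension g' (\<psi> y) = (1 / of_real B) * extension g (\<psi> y)"
      unfolding g'_def by (rule extension_cmult [OF g])
    ultimately have "cmod ((1 / of_real B) * H y) \<le> 3 * sqrt (1 - cmod (y $ i))"
      by (simp add: H_def coord [OF y] algebra_simps diff_divide_distrib)
    then show ?thesis
      using B(1) by (simp add: norm_mult norm_divide pos_divide_le_eq mult_ac)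
  qed
  have "H (vec_upd i (z $ i) z) = 0"
  proof (rule boundary_zero_imp_zero [OF slice])
    show "cmod (H (vec_upd i w z)) \<le> 3 * B * sqrt (1 - cmod w)" if "cmod w < 1" for w
      using H_le [of "vec_upd i w z"] vec_upd_polydisk [of z w i] that z by (simp add: Omega_eq)
    show "cmod (z $ i) < 1" using z polydisk_nth by (simp add: Omega_eq)
  qed
  then show ?thesis by (simp add: H_def)
qed

lemma retract_polydisk: "retract_of_dom V \<Omega>"
proof -
  \<comment> \<open>Minimising the cardinality over all factor maps lets \<open>min\<close> apply to
    every factor map over the chosen \<open>I\<close>, not only to \<open>\<psi>\<close>.\<close>
  define good where "good n \<longleftrightarrow> (\<exists>I \<psi>. card I = n \<and> factor_map I \<psi>)" for n
  have "factor_map UNIV (\<lambda>z. z)"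
    unfolding factor_map_def by (auto simp: vec_eq_iff holo_map_on_def holo_on_coord open_dom)
  then have "good (card (UNIV :: 'a set))" unfolding good_def by blast
  then have "good (LEAST n. good n)" by (rule LeastI)
  then obtain I \<psi> where I: "card I = (LEAST n. good n)" and \<psi>: "factor_map I \<psi>"
    unfolding good_def by blast
  have min: "\<phi> z $ i = z $ i" if \<phi>: "factor_map I \<phi>" and i: "i \<in> I" and z: "z \<in> \<Omega>" for \<phi> i z
  proof (rule ccontr)
    assume "\<phi> z $ i \<noteq> z $ i"
    then obtain \<psi>' where "factor_map (I - {i}) \<psi>'"
      using factor_map_drop_coord [OF \<phi> i z] by blast
    then have "good (card (I - {i}))" unfolding good_def by blast
    then have "(LEAST n. good n) \<le> card (I - {i})" by (rule Least_le)
    moreover have "card (I - {i}) < card I" using i by (intro card_Diff1_less) simp_all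
    ultimately show False using I by simp
  qed
  have hol: "holo_map_on \<psi> \<Omega>" and dom: "\<psi> ` \<Omega> \<subseteq> \<Omega>" and fixV: "\<And>x. x \<in> V \<Longrightarrow> \<psi> x = x"
    and dep: "\<And>z z'. z \<in> \<Omega> \<Longrightarrow> z' \<in> \<Omega> \<Longrightarrow> \<forall>j\<in>I. z $ j = z' $ j \<Longrightarrow> \<psi> z = \<psi> z'"
    using \<psi> unfolding factor_map_def by blast+
  \<comment> \<open>Composition with \<open>coord_map\<close> keeps \<open>I\<close>, so minimality
    applies again and identifies the extended coordinates along \<open>\<psi>\<close>.\<close>
  have "factor_map I (\<lambda>z. coord_map (\<psi> z))"
    unfolding factor_map_def
  proof (intro conjI ballI impI)
    show "holo_map_on (\<lambda>z. coord_map (\<psi> z)) \<Omega>" by (rule holo_map_on_compose [OF coord_map_holo hol dom])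
    show "(\<lambda>z. coord_map (\<psi> z)) ` \<Omega> \<subseteq> \<Omega>" using dom coord_map_dom by blast
    show "coord_map (\<psi> x) = x" if "x \<in> V" for x using fixV coord_map_fix that by simp
    show "coord_map (\<psi> z) = coord_map (\<psi> z')" if "z \<in> \<Omega>" "z' \<in> \<Omega>" "\<forall>j\<in>I. z $ j = z' $ j" for z z'
      using dep [OF that] by simp
  qed
  from min [OF this] have coord: "extension (\<lambda>x. x $ i) (\<psi> z) = z $ i" if "i \<in> I" "z \<in> \<Omega>" for i z
    using that by (simp add: coord_map_def)
  define mix where "mix J x z = (\<chi> j. if j \<in> J then x $ j else z $ j)" for J and x z :: "complex^'a"
  \<comment> \<open>Telescoping: the coordinates in \<open>I\<close> are frozen at those of
    \<open>x\<close> one at a time. Each change has the form \<open>(z $ i - x $ i) * g z\<close>,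
    which the state at \<open>\<psi> x\<close> annihilates. Once all of \<open>I\<close> is frozen,
    \<open>h_dep\<close> leaves a constant.\<close>
  have extension_h: "extension h (\<psi> x) = h x" if h: "bounded_holo_on h \<Omega>" and x: "x \<in> \<Omega>"
    and h_dep: "\<And>z. z \<in> \<Omega> \<Longrightarrow> \<forall>j\<in>I. z $ j = x $ j \<Longrightarrow> h z = h x" for h x
  proof -
    have mix_dom: "mix J x z \<in> \<Omega>" if "z \<in> \<Omega>" for J z
      using x that by (simp add: Omega_eq polydisk_def mix_def)
    have mix_h: "bounded_holo_on (\<lambda>z. h (mix J x z)) \<Omega>" for J
    proof (rule bounded_holo_on_compose [OF h])
      show "holo_map_on (mix J x) \<Omega>"
        unfolding holo_map_on_def
      proof
        fix j show "holo_on (\<lambda>z. mix J x z $ j) \<Omega>"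
          by (cases "j \<in> J") (simp_all add: mix_def holo_on_const holo_on_coord open_dom)
      qed
    qed (use mix_dom in blast)
    have px: "\<psi> x \<in> \<Omega>" using dom x by blast
    have "J \<subseteq> I \<Longrightarrow> extension h (\<psi> x) = extension (\<lambda>z. h (mix J x z)) (\<psi> x)" if "finite J" for J
      using that
    proof (induction J rule: finite_induct)
      case empty
      then show ?case by (simp add: mix_def)
    next
      case (insert i J)
      have xi: "cmod (x $ i) < 1" using polydisk_nth x by (simp add: Omega_eq)
      obtain g where g: "bounded_holo_on g \<Omega>"
        and hg: "\<And>z. z \<in> \<Omega> \<Longrightarrow> h (mix J x z) - h (mix J x (vec_upd i (x $ i) z)) = (z $ i - x $ i) * g z"
        using polydisk_divide [of "\<lambda>z. h (mix J x z)" "x $ i" i, folded Omega_eq, OF mix_h xi] by blast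
      have mix_ins: "mix J x (vec_upd i (x $ i) z) = mix (insert i J) x z" for z
        by (simp add: mix_def vec_eq_iff)
      note ig = bounded_holo_on_mult [OF bh_poly [OF poly_fun.coord [of i]] g]
      have "extension (\<lambda>z. h (mix J x z)) (\<psi> x) - extension (\<lambda>z. h (mix (insert i J) x z)) (\<psi> x)
          = extension (\<lambda>z. h (mix J x z) - h (mix (insert i J) x z)) (\<psi> x)"
        by (rule extension_diff [OF mix_h mix_h, symmetric])
      also have "extension (\<lambda>z. h (mix J x z) - h (mix (insert i J) x z)) = extension (\<lambda>z. z $ i * g z - x $ i * g z)"
      proof (rule extension_cong)
        fix y assume "y \<in> V"
        then show "h (mix J x y) - h (mix (insert i J) x y) = y $ i * g y - x $ i * g y"
          using hg [of y] V_sub by (auto simp: mix_ins algebra_simps)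
      qed
      also have "extension (\<lambda>z. z $ i * g z - x $ i * g z) (\<psi> x) = extension (\<lambda>z. z $ i * g z) (\<psi> x) - x $ i * extension g (\<psi> x)"
        by (simp add: extension_diff [OF ig bounded_holo_on_cmult [OF g]] extension_cmult [OF g])
      also have "\<dots> = 0"
        using extension_coord_multiplicative [OF hol dom coord g x] insert.prems by simp
      finally show ?case using insert by simp
    qed
    from this [of I] have "extension h (\<psi> x) = extension (\<lambda>z. h (mix I x z)) (\<psi> x)" by simp
    also have "extension (\<lambda>z. h (mix I x z)) = extension (\<lambda>z. h x)"
      by (rule extension_cong, rule h_dep) (use mix_dom V_sub in \<open>auto simp: mix_def\<close>)
    also have "extension (\<lambda>z. h x) (\<psi> x) = h x" by (rule extension_const [OF px])
    finally show ?thesis .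
  qed
  show ?thesis
  proof (rule retract_if_poly_bound [OF hol dom fixV])
    fix p :: "complex^'a \<Rightarrow> complex" and z
    assume p: "poly_fun p" and z: "z \<in> \<Omega>"
    \<comment> \<open>The composite of \<open>p\<close> with \<open>\<psi>\<close> depends only on
      the coordinates in \<open>I\<close>, and it agrees with \<open>p\<close> on \<open>V\<close>,
      so both have the same extension.\<close>
    have "extension (\<lambda>z. p (\<psi> z)) (\<psi> z) = p (\<psi> z)"
      by (rule extension_h [OF bounded_holo_on_compose [OF bh_poly [OF p] hol dom] z])
        (use dep z in metis)
    moreover have "extension (\<lambda>z. p (\<psi> z)) = extension p"
      by (rule extension_cong) (simp add: fixV)
    ultimately show "cmod (p (\<psi> z)) \<le> (SUP x\<in>V. cmod (p x))"
      using extension_le_SUP [OF bh_poly [OF p], of "\<psi> z"] dom z by auto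
  qed
qed

end

theorem theorem1p6:
  fixes \<Omega> V :: "(complex^'n::finite) set"
    and E :: "(complex^'n \<Rightarrow> complex) \<Rightarrow> (complex^'n \<Rightarrow> complex)"
  assumes dom: "domain \<Omega>" and bdd: "bounded \<Omega>" and cvx: "convex \<Omega>" and bal: "balanced \<Omega>"
    and var: "analytic_subvariety V \<Omega>" and ne: "V \<noteq> {}"
    and pc: "rel_poly_convex V \<Omega>"
    and E_maps: "\<forall>f\<in>Hinf V. E f \<in> Hinf \<Omega>"
    and E_add: "\<forall>f\<in>Hinf V. \<forall>g\<in>Hinf V. E (\<lambda>x. f x + g x) = (\<lambda>x. E f x + E g x)"
    and E_smult: "\<forall>f\<in>Hinf V. \<forall>c::complex. E (\<lambda>x. c * f x) = (\<lambda>x. c * E f x)"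
    and E_ext: "\<forall>f\<in>Hinf V. \<forall>x\<in>V. E f x = f x"
    and E_isom: "\<forall>f\<in>Hinf V. (SUP x\<in>\<Omega>. cmod (E f x)) = (SUP x\<in>V. cmod (f x))"
    and cases: "\<Omega> = polydisk \<or> strictly_convex \<Omega> \<or>
               (\<forall>f\<in>Hinf V. \<forall>g\<in>Hinf V. E (\<lambda>x. f x * g x) = (\<lambda>x. E f x * E g x))"
  shows "retract_of_dom V \<Omega>"
proof -
  interpret isometric_extension \<Omega> V E
    by unfold_locales
      (use assms in \<open>simp_all add: domain_def analytic_subvariety_def\<close>)
  consider "\<Omega> = polydisk" | "strictly_convex \<Omega>"
    | "\<forall>f\<in>Hinf V. \<forall>g\<in>Hinf V. E (\<lambda>x. f x * g x) = (\<lambda>x. E f x * E g x)"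
    using cases by blast
  then show ?thesis
  proof cases
    case 1
    then interpret polydisk_extension \<Omega> V E by unfold_locales
    show ?thesis by (rule retract_polydisk)
  next
    case 2
    then show ?thesis by (rule retract_if_strictly_convex)
  next
    case 3
    then show ?thesis by (intro retract_if_multiplicative) blast
  qed
qed

end
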